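(* Let $B=(B_t)_{t\ge 0}$ be a standard one-dimensional Brownian motion started at $0$ and let $T_1=\inf\{t\ge 0: B_t=1\}$. The random variable $$A_1^{(1)}=\frac{1}{T_1^{3/2}}\int_0^{T_1}B_s\,ds$$ admits moments of all orders and is centered, i.e. $\mathbb{E}[A_1^{(1)}]=0$.
   Context: "Admits moments of all orders" means that $\mathbb{E}[|A_1^{(1)}|^r]<+\infty$ for every $r>0$. *)

theory Defs
  imports "HOL-Probability.Probability"
begin

text \<open>
  A process is a family \<open>B :: real \<Rightarrow> 'a \<Rightarrow> real\<close>, of which only the times \<open>t \<ge> 0\<close> matter.
  All paths are required to be continuous (not merely almost all of them): \<open>M\<close> is not
  assumed complete, and otherwise the hitting time below need not be measurable.
\<close>

locale standard_brownian_motion = prob_space M for M :: "'a measure" +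
  fixes B :: "real \<Rightarrow> 'a \<Rightarrow> real"
  assumes random_variable_at: "\<And>t. 0 \<le> t \<Longrightarrow> B t \<in> borel_measurable M"
    and starts_at_0: "AE \<omega> in M. B 0 \<omega> = 0"
    and continuous_paths: "\<And>\<omega>. \<omega> \<in> space M \<Longrightarrow> continuous_on {0..} (\<lambda>t. B t \<omega>)"
    and indep_increments:
      "\<And>(n::nat) (t :: nat \<Rightarrow> real). 0 \<le> t 0 \<Longrightarrow> mono_on {..n} t \<Longrightarrow>
         indep_vars (\<lambda>_. borel) (\<lambda>i \<omega>. B (t (Suc i)) \<omega> - B (t i) \<omega>) {..<n}"
    and normal_increments:
      "\<And>s t. 0 \<le> s \<Longrightarrow> s < t \<Longrightarrow>
         distributed M lborel (\<lambda>\<omega>. B t \<omega> - B s \<omega>) (normal_density 0 (sqrt (t - s)))"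

text \<open>Extended-valued, so that a level which is never reached has hitting time \<open>\<infinity>\<close>.\<close>

definition hitting_time :: "(real \<Rightarrow> 'a \<Rightarrow> real) \<Rightarrow> real \<Rightarrow> 'a \<Rightarrow> ennreal" where
  "hitting_time B a \<omega> = (INF t\<in>{t. 0 \<le> t \<and> B t \<omega> = a}. ennreal t)"

text \<open>
  On the null event \<open>hitting_time B 1 \<omega> = \<infinity>\<close>, where the quotient has no meaning,
  \<open>enn2real \<infinity> = 0\<close> gives the value \<open>0\<close>.
\<close>

definition normalized_area :: "(real \<Rightarrow> 'a \<Rightarrow> real) \<Rightarrow> 'a \<Rightarrow> real" where
  "normalized_area B \<omega> =
     (let T = enn2real (hitting_time B 1 \<omega>)
      in 1 / T powr (3 / 2) * (LBINT s:{0..T}. B s \<omega>))"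

text \<open>
  Measurability is stated explicitly because the nonnegative integral is also
  defined (as a lower integral) for functions that are not measurable.
\<close>

definition (in prob_space) admits_moments_of_all_orders :: "('a \<Rightarrow> real) \<Rightarrow> bool" where
  "admits_moments_of_all_orders X \<longleftrightarrow>
     random_variable borel X \<and> (\<forall>r::real. r > 0 \<longrightarrow> (\<integral>\<^sup>+\<omega>. ennreal (\<bar>X \<omega>\<bar> powr r) \<partial>M) < \<infinity>)"

end

theory Submission
  imports Defs "HOL-Real_Asymp.Real_Asymp"
begin

text \<open>
  Let \<open>W = B - B\<^sub>0\<close>, \<open>T\<close> the first time at which \<open>W\<close> is \<open>1\<close>, \<open>I = \<integral>\<^sub>0\<^sup>T W\<^sub>s ds\<close>, so that the
  variable in question is \<open>A = I / T\<^bsup>3/2\<^esup>\<close>. The power of \<open>T\<close> is a mixture of exponentials,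
  \<open>T\<^bsup>-3/2\<^esup>\<close> being proportional to \<open>\<integral>\<^sub>0\<^sup>\<infinity> c\<^sup>2 exp (- c\<^sup>2 T / 2) dc\<close>, and functionals of the path up
  to \<open>T\<close> that are weighted by \<open>exp (- c\<^sup>2 T / 2)\<close> are accessible to martingales.

  For \<open>\<kappa> = a\<^sup>2 / 2 + c a\<close>, both \<open>M\<^sub>t = exp (c W\<^sub>t - c\<^sup>2 t / 2)\<close> and
  \<open>M\<^sub>t \<integral>\<^sub>0\<^sup>t exp (a W\<^sub>s) ds - \<kappa>\<inverse> M\<^sub>t exp (a W\<^sub>t)\<close> are martingales. Stopping them at \<open>T\<close>, where
  \<open>W = 1\<close>, gives \<open>E[exp (- c\<^sup>2 T / 2)] = exp (- c)\<close> and
  \<open>E[exp (- c\<^sup>2 T / 2) \<integral>\<^sub>0\<^sup>T exp (a W\<^sub>s) ds] = exp (- c) (exp a - 1) / \<kappa>\<close>. The second formula is proved for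
  \<open>a > 0\<close> (\<open>discounted_area_eq\<close>); for \<open>a \<ge> - c\<close>, \<open>a \<noteq> 0\<close> there is the inequality that Fatou's lemma
  yields (\<open>discounted_area_le\<close>).

  Moments. Jensen's inequality bounds \<open>T exp (a I / T)\<close> by \<open>\<integral>\<^sub>0\<^sup>T exp (a W\<^sub>s) ds\<close>. With \<open>a = c / 2\<close> and
  \<open>a = - c / 2\<close> this bounds \<open>E[c T exp (- c\<^sup>2 T / 2) (exp (c I / 2 T) + exp (- c I / 2 T))]\<close> by a
  multiple of \<open>exp (- c / 2)\<close>, which is integrable in \<open>c > 0\<close>. On the other hand, in the variable
  \<open>v = c T\<^bsup>1/2\<^esup>\<close> the integral over \<open>c\<close> of the expression inside the expectation depends on \<open>A\<close>
  alone, and the part \<open>1 \<le> v \<le> 2\<close> is at least \<open>exp (\<bar>A\<bar> / 2 - 2)\<close>. Hence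
  \<open>E[exp (\<bar>A\<bar> / 2)]\<close> is finite (\<open>exponential_moment_normalized_area\<close>).

  Mean. The derivative at \<open>a = 0\<close> of the formula above is
  \<open>E[exp (- c\<^sup>2 T / 2) I] = exp (- c) (1 / (2 c) - 1 / (2 c\<^sup>2))\<close> (\<open>discounted_first_moment\<close>).
  Multiplying by \<open>c\<^sup>2\<close> and integrating over \<open>c > 0\<close>, \<open>E[A]\<close> is a multiple of
  \<open>\<integral>\<^sub>0\<^sup>\<infinity> (c - 1) exp (- c) dc = 0\<close>.

  Optional stopping is reduced to discrete time. On a grid of mesh \<open>h\<close> the martingales
  are still exact once \<open>\<kappa>\<inverse>\<close> is replaced by \<open>h / (exp (\<kappa> h) - 1)\<close> and the integral by a Riemann sum
  (\<open>stopped_area\<close>). Dyadic refinement gives the formulas at the first passage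
  over a level \<open>l\<close>, capped at a time \<open>K\<close>; these capped times then tend to \<open>T\<close> as \<open>l\<close> increases to \<open>1\<close>
  and \<open>K\<close> to infinity.
\<close>

section \<open>Integrals along a grid\<close>

lemma grid_point_tendsto:
  fixes s :: real
  assumes s: "0 \<le> s" and h: "\<And>m. 0 < h m" "h \<longlonglongrightarrow> 0"
  shows "\<And>m. real (nat \<lfloor>s / h m\<rfloor>) * h m \<le> s" "(\<lambda>m. real (nat \<lfloor>s / h m\<rfloor>) * h m) \<longlonglongrightarrow> s"
proof -
  have bounds: "real (nat \<lfloor>s / h m\<rfloor>) * h m \<le> s" "s - h m \<le> real (nat \<lfloor>s / h m\<rfloor>) * h m" for m
  proof -
    have eq: "real (nat \<lfloor>s / h m\<rfloor>) = of_int \<lfloor>s / h m\<rfloor>"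
      using s h(1)[of m] by (intro of_nat_nat) simp
    have "real_of_int \<lfloor>s / h m\<rfloor> \<le> s / h m" "s / h m - 1 \<le> real_of_int \<lfloor>s / h m\<rfloor>"
      by linarith+
    from mult_right_mono[OF this(1), of "h m"] mult_right_mono[OF this(2), of "h m"]
    show "real (nat \<lfloor>s / h m\<rfloor>) * h m \<le> s" "s - h m \<le> real (nat \<lfloor>s / h m\<rfloor>) * h m"
      using h(1)[of m] unfolding eq left_diff_distrib by auto
  qed
  show "\<And>m. real (nat \<lfloor>s / h m\<rfloor>) * h m \<le> s" by fact
  have "(\<lambda>m. s - h m) \<longlonglongrightarrow> s"
    using tendsto_diff[OF tendsto_const[of s] h(2)] by simp
  then show "(\<lambda>m. real (nat \<lfloor>s / h m\<rfloor>) * h m) \<longlonglongrightarrow> s"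
    by (rule tendsto_sandwich[rotated 2, OF _ tendsto_const]) (use bounds in auto)
qed

lemma dyadic_mesh:
  assumes "0 < K"
  shows "0 < K / 2 ^ m" "(\<lambda>m. K / 2 ^ m :: real) \<longlonglongrightarrow> 0"
  using assms by (auto intro!: LIMSEQ_divide_realpow_zero)

text \<open>
  The error is added up cell by cell, so that the upper end of the integral may be any grid point;
  stopping at a random grid point needs this uniformity.
\<close>

lemma riemann_sum_error:
  fixes f :: "real \<Rightarrow> real"
  assumes f: "continuous_on {0..K} f" and h: "0 < h" and "real k * h \<le> K"
    and osc: "\<And>x y. x \<in> {0..K} \<Longrightarrow> y \<in> {0..K} \<Longrightarrow> \<bar>x - y\<bar> \<le> h \<Longrightarrow> \<bar>f x - f y\<bar> \<le> e"
  shows "\<bar>(\<Sum>j<k. h * f (real j * h)) - integral {0..real k * h} f\<bar> \<le> e * (real k * h)"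
  using \<open>real k * h \<le> K\<close>
proof (induction k)
  case 0
  then show ?case by simp
next
  case (Suc k)
  define u v where "u = real k * h" and "v = real (Suc k) * h"
  have uv: "0 \<le> u" "u \<le> v" "v = u + h" "v \<le> K"
    using h Suc.prems by (auto simp: u_def v_def algebra_simps)
  have int: "f integrable_on {u..v}" "f integrable_on {0..v}"
    using uv by (auto intro!: integrable_continuous_real continuous_on_subset[OF f])
  have split: "integral {0..u} f + integral {u..v} f = integral {0..v} f"
    using uv int by (intro Henstock_Kurzweil_Integration.integral_combine) auto
  have "h * f u - integral {u..v} f = integral {u..v} (\<lambda>x. f u - f x)"
    using int uv by (subst Henstock_Kurzweil_Integration.integral_diff) auto
  moreover have "\<bar>integral {u..v} (\<lambda>x. f u - f x)\<bar> \<le> integral {u..v} (\<lambda>x. e)"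
    using uv osc unfolding real_norm_def[symmetric]
    by (intro integral_norm_bound_integral integrable_diff int(1) integrable_const_ivl) auto
  ultimately have step: "\<bar>h * f u - integral {u..v} f\<bar> \<le> e * h"
    using uv by (simp add: mult.commute)
  have IH: "\<bar>(\<Sum>j<k. h * f (real j * h)) - integral {0..u} f\<bar> \<le> e * u"
    unfolding u_def using Suc.prems h by (intro Suc.IH) (auto simp: algebra_simps)
  have "(\<Sum>j<Suc k. h * f (real j * h)) - integral {0..v} f
      = ((\<Sum>j<k. h * f (real j * h)) - integral {0..u} f) + (h * f u - integral {u..v} f)"
    unfolding split[symmetric] by (simp add: u_def)
  also have "\<bar>\<dots>\<bar> \<le> e * u + e * h"
    using IH step by linarith
  also have "\<dots> = e * v"
    by (simp add: uv algebra_simps)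
  finally show ?case
    by (simp add: v_def)
qed

lemma riemann_sum_tendsto:
  fixes f :: "real \<Rightarrow> real"
  assumes f: "continuous_on {0..K} f" and h: "\<And>m. 0 < h m" "h \<longlonglongrightarrow> 0"
    and k: "\<And>m. real (k m) * h m \<le> K" "(\<lambda>m. real (k m) * h m) \<longlonglongrightarrow> \<tau>"
  shows "(\<lambda>m. \<Sum>j<k m. h m * f (real j * h m)) \<longlonglongrightarrow> integral {0..\<tau>} f"
proof -
  have nonneg: "0 \<le> real (k m) * h m" for m
    using h(1)[of m] by (simp add: less_imp_le)
  have K: "0 \<le> K"
    using nonneg[of 0] k(1)[of 0] by linarith
  have tau: "\<tau> \<in> {0..K}"
    using k nonneg by (auto intro: LIMSEQ_le_const LIMSEQ_le_const2)
  have err: "(\<lambda>m. (\<Sum>j<k m. h m * f (real j * h m)) - integral {0..real (k m) * h m} f) \<longlonglongrightarrow> 0"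
  proof (rule LIMSEQ_I)
    fix r :: real assume r: "0 < r"
    define e where "e = r / (2 * (K + 1))"
    have e: "0 < e" using r K by (simp add: e_def)
    have "uniformly_continuous_on {0..K} f"
      using f by (intro compact_uniformly_continuous) auto
    then obtain d where d: "0 < d" "\<And>x y. x \<in> {0..K} \<Longrightarrow> y \<in> {0..K} \<Longrightarrow> dist y x < d \<Longrightarrow> dist (f y) (f x) < e"
      using e unfolding uniformly_continuous_on_def by blast
    obtain n where n: "\<And>m. n \<le> m \<Longrightarrow> h m < d"
      using LIMSEQ_D[OF h(2) d(1)] by force
    have "norm ((\<Sum>j<k m. h m * f (real j * h m)) - integral {0..real (k m) * h m} f - 0) < r"
      if "n \<le> m" for m
    proof -
      have "\<bar>(\<Sum>j<k m. h m * f (real j * h m)) - integral {0..real (k m) * h m} f\<bar> \<le> e * (real (k m) * h m)"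
      proof (rule riemann_sum_error[OF f h(1) k(1)])
        fix x y assume "x \<in> {0..K}" "y \<in> {0..K}" "\<bar>x - y\<bar> \<le> h m"
        then show "\<bar>f x - f y\<bar> \<le> e"
          using d(2)[of x y] n[OF that] by (simp add: dist_real_def abs_minus_commute)
      qed
      also have "\<dots> \<le> e * K"
        using e k(1) by (intro mult_left_mono) auto
      also have "\<dots> < r"
        using r K by (simp add: e_def divide_simps)
      finally show ?thesis by simp
    qed
    then show "\<exists>n. \<forall>m\<ge>n. norm ((\<Sum>j<k m. h m * f (real j * h m)) - integral {0..real (k m) * h m} f - 0) < r"
      by blast
  qed
  have "continuous_on {0..K} (\<lambda>x. integral {0..x} f)"
    using f by (intro indefinite_integral_continuous_1 integrable_continuous_real)
  then have "(\<lambda>m. integral {0..real (k m) * h m} f) \<longlonglongrightarrow> integral {0..\<tau>} f"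
    by (rule continuous_on_tendsto_compose[OF _ k(2) tau]) (use nonneg k(1) in auto)
  from tendsto_add[OF err this] show ?thesis by simp
qed

lemma indefinite_integral_tendsto:
  fixes f :: "real \<Rightarrow> real"
  assumes f: "continuous_on {0..} f" and x: "\<And>n. 0 \<le> x n" "x \<longlonglongrightarrow> y"
  shows "(\<lambda>n. integral {0..x n} f) \<longlonglongrightarrow> integral {0..y} f"
proof (rule continuous_on_tendsto_compose[where f = "\<lambda>t. integral {0..t} f" and s = "{0..y + 1}"])
  show "continuous_on {0..y + 1} (\<lambda>t. integral {0..t} f)"
    by (intro indefinite_integral_continuous_1 integrable_continuous_real continuous_on_subset[OF f]) auto
  have "0 \<le> y" using x by (blast intro: LIMSEQ_le_const)
  then show "y \<in> {0..y + 1}" by simp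
  have "eventually (\<lambda>n. x n < y + 1) sequentially"
    using x(2) by (rule order_tendstoD) simp
  then show "eventually (\<lambda>n. x n \<in> {0..y + 1}) sequentially"
    by eventually_elim (use x(1) in \<open>auto intro: less_imp_le\<close>)
qed (rule x(2))

lemma set_lebesgue_integral_eq_integral_continuous:
  fixes f :: "real \<Rightarrow> real"
  assumes "continuous_on {0..} f"
  shows "(LBINT s:{0..t}. f s) = integral {0..t} f"
  by (intro set_borel_integral_eq_integral borel_integrable_atLeastAtMost' continuous_on_subset[OF assms]) auto

section \<open>First passage of a continuous function over a level\<close>

text \<open>
  The cap \<open>n\<close> makes the least index exist, and it turns the index into a bounded stopping time.
\<close>

definition passage_index :: "(nat \<Rightarrow> real) \<Rightarrow> real \<Rightarrow> nat \<Rightarrow> nat" where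
  "passage_index x l n = (LEAST i. n \<le> i \<or> l \<le> x i)"

lemma passage_index_le: "passage_index x l n \<le> n"
  unfolding passage_index_def by (rule Least_le) simp

lemma passage_index_reaches: "passage_index x l n < n \<Longrightarrow> l \<le> x (passage_index x l n)"
  unfolding passage_index_def
  using LeastI[of "\<lambda>i. n \<le> i \<or> l \<le> x i" n] by auto

lemma below_before_passage_index: "i < passage_index x l n \<Longrightarrow> x i < l"
  unfolding passage_index_def using not_less_Least[of i "\<lambda>i. n \<le> i \<or> l \<le> x i"] by auto

lemma passage_index_eq:
  assumes "\<And>j. j < n \<Longrightarrow> x j < l"
  shows "passage_index x l n = n"
proof (rule ccontr)
  assume "passage_index x l n \<noteq> n"
  then have "passage_index x l n < n" using passage_index_le[of x l n] by linarith
  from passage_index_reaches[OF this] assms[OF this] show False by simp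
qed

lemma passage_index_Suc:
  "passage_index x l (Suc n) = (if \<forall>j\<le>n. x j < l then Suc n else passage_index x l n)"
proof (cases "\<forall>j\<le>n. x j < l")
  case True
  then show ?thesis by (simp add: passage_index_eq)
next
  case False
  then obtain j where j: "j \<le> n" "l \<le> x j" by force
  have "(LEAST i. Suc n \<le> i \<or> l \<le> x i) = (LEAST i. n \<le> i \<or> l \<le> x i)"
  proof (rule Least_equality)
    have "(LEAST i. n \<le> i \<or> l \<le> x i) \<le> j" using j by (intro Least_le) simp
    then show "Suc n \<le> (LEAST i. n \<le> i \<or> l \<le> x i) \<or> l \<le> x (LEAST i. n \<le> i \<or> l \<le> x i)"
      using LeastI[of "\<lambda>i. n \<le> i \<or> l \<le> x i" j] j
      by (cases "(LEAST i. n \<le> i \<or> l \<le> x i) = j") auto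
  next
    fix i assume "Suc n \<le> i \<or> l \<le> x i"
    then show "(LEAST i. n \<le> i \<or> l \<le> x i) \<le> i" by (intro Least_le) auto
  qed
  with False show ?thesis by (auto simp: passage_index_def)
qed

definition dyadic_passage :: "(real \<Rightarrow> real) \<Rightarrow> real \<Rightarrow> real \<Rightarrow> nat \<Rightarrow> real" where
  "dyadic_passage f l K m = real (passage_index (\<lambda>i. f (real i * (K / 2 ^ m))) l (2 ^ m)) * (K / 2 ^ m)"

lemma dyadic_passage_bounds:
  assumes "0 < K" shows "0 \<le> dyadic_passage f l K m" "dyadic_passage f l K m \<le> K"
proof -
  show "0 \<le> dyadic_passage f l K m" using assms by (simp add: dyadic_passage_def)
  have "dyadic_passage f l K m \<le> real (2 ^ m) * (K / 2 ^ m)"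
    unfolding dyadic_passage_def
    using assms passage_index_le by (intro mult_right_mono) (auto simp flip: of_nat_power)
  then show "dyadic_passage f l K m \<le> K" by simp
qed

text \<open>
  The grids are nested: a grid point of level \<open>m\<close> with index \<open>i\<close> is the point of level \<open>m + 1\<close>
  with index \<open>2 * i\<close>.
\<close>

lemma dyadic_passage_decseq:
  assumes "0 < K" shows "decseq (dyadic_passage f l K)"
proof (rule decseq_SucI)
  fix m
  let ?x = "\<lambda>m i. f (real i * (K / 2 ^ m))"
  have eq: "?x (Suc m) (2 * i) = ?x m i" for i by simp
  have "2 ^ Suc m \<le> 2 * passage_index (?x m) l (2 ^ m) \<or> l \<le> ?x (Suc m) (2 * passage_index (?x m) l (2 ^ m))"
    unfolding eq using passage_index_reaches[of "?x m" l "2 ^ m"] by (cases "passage_index (?x m) l (2 ^ m) < 2 ^ m") auto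
  then have "passage_index (?x (Suc m)) l (2 ^ Suc m) \<le> 2 * passage_index (?x m) l (2 ^ m)"
    unfolding passage_index_def[of "?x (Suc m)"] by (rule Least_le)
  then have "real (passage_index (?x (Suc m)) l (2 ^ Suc m)) \<le> 2 * real (passage_index (?x m) l (2 ^ m))"
    by linarith
  then show "dyadic_passage f l K (Suc m) \<le> dyadic_passage f l K m"
    using assms by (simp add: dyadic_passage_def field_simps)
qed

text \<open>
  For continuous \<open>f\<close> with \<open>f 0 \<le> l\<close> this lies between the first time at which \<open>f\<close> reaches \<open>l\<close> and the
  infimum of the times at which \<open>f\<close> exceeds \<open>l\<close>, both capped at \<open>K\<close>. The two may differ if \<open>f\<close> touches \<open>l\<close>
  between grid points.
\<close>

definition passage_time :: "(real \<Rightarrow> real) \<Rightarrow> real \<Rightarrow> real \<Rightarrow> real" where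
  "passage_time f l K = lim (dyadic_passage f l K)"

lemma dyadic_passage_tendsto:
  assumes "0 < K" shows "dyadic_passage f l K \<longlonglongrightarrow> passage_time f l K"
proof -
  have "Bseq (dyadic_passage f l K)"
    using dyadic_passage_bounds[OF assms, of f l]
    by (intro BseqI'[of _ K]) (simp add: abs_le_iff)
  then have "convergent (dyadic_passage f l K)"
    using dyadic_passage_decseq[OF assms] by (intro Bseq_monoseq_convergent) (auto simp: monoseq_iff)
  then show ?thesis
    by (simp add: convergent_LIMSEQ_iff passage_time_def)
qed

lemma passage_time_bounds:
  assumes "0 < K" shows "0 \<le> passage_time f l K" "passage_time f l K \<le> K"
  using dyadic_passage_bounds[OF assms]
  by (blast intro: LIMSEQ_le_const[OF dyadic_passage_tendsto[OF assms]]
      LIMSEQ_le_const2[OF dyadic_passage_tendsto[OF assms]])+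

text \<open>
  At grid points before the passage \<open>f\<close> is below \<open>l\<close>; grid points are dense, and \<open>f\<close> is continuous.
\<close>

lemma le_level_before_passage_time:
  assumes K: "0 < K" and f: "continuous_on {0..} f" "f 0 \<le> l"
    and s: "0 \<le> s" "s \<le> passage_time f l K"
  shows "f s \<le> l"
proof -
  let ?\<tau> = "passage_time f l K"
  have below: "f s \<le> l" if s: "0 \<le> s" "s < ?\<tau>" for s
  proof -
    define d where "d m = real (nat \<lfloor>s / (K / 2 ^ m)\<rfloor>) * (K / 2 ^ m)" for m :: nat
    have d: "0 \<le> d m" "d m \<le> s" "d \<longlonglongrightarrow> s" for m
      using grid_point_tendsto[OF s(1), of "\<lambda>m. K / 2 ^ m"] dyadic_mesh[OF K] K
      by (simp_all add: d_def[abs_def])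
    have "f (d m) < l" for m
    proof -
      have "d m < dyadic_passage f l K m"
        using d(2)[of m] s decseq_ge[OF dyadic_passage_decseq[OF K] dyadic_passage_tendsto[OF K], of f l m]
        by linarith
      then have "nat \<lfloor>s / (K / 2 ^ m)\<rfloor> < passage_index (\<lambda>i. f (real i * (K / 2 ^ m))) l (2 ^ m)"
        using K by (simp add: d_def dyadic_passage_def divide_less_cancel)
      from below_before_passage_index[OF this] show ?thesis by (simp add: d_def)
    qed
    moreover have "(\<lambda>m. f (d m)) \<longlonglongrightarrow> f s"
      by (rule continuous_on_tendsto_compose[OF f(1) d(3)]) (use s d in auto)
    ultimately show ?thesis
      by (intro LIMSEQ_le_const2) (auto intro: less_imp_le)
  qed
  show ?thesis
  proof (cases "s < ?\<tau> \<or> s = 0")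
    case True
    then show ?thesis using below s f(2) by auto
  next
    case False
    then have s: "s = ?\<tau>" "0 < s" using s by auto
    \<comment> \<open>the passage time itself is a limit of earlier times\<close>
    define r where "r n = s * (1 - 1 / (real n + 1))" for n :: nat
    have "(\<lambda>n. 1 / (real n + 1)) \<longlonglongrightarrow> 0"
      using LIMSEQ_inverse_real_of_nat by (simp add: inverse_eq_divide add.commute)
    then have "r \<longlonglongrightarrow> s * (1 - 0)"
      unfolding r_def by (intro tendsto_intros)
    then have lim: "r \<longlonglongrightarrow> s" by simp
    have r: "0 \<le> r n" "r n < s" for n
      using s by (auto simp: r_def field_simps)
    have "(\<lambda>n. f (r n)) \<longlonglongrightarrow> f s"
      by (rule continuous_on_tendsto_compose[OF f(1) lim]) (use s r in auto)
    then show ?thesis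
      by (rule LIMSEQ_le_const2) (use below r s in auto)
  qed
qed

lemma passage_time_reaches:
  assumes K: "0 < K" and f: "continuous_on {0..} f" "f 0 \<le> l"
    and less: "passage_time f l K < K"
  shows "f (passage_time f l K) = l"
proof (rule antisym)
  show "f (passage_time f l K) \<le> l"
    using le_level_before_passage_time[OF K f] passage_time_bounds[OF K] by blast
  have "eventually (\<lambda>m. dyadic_passage f l K m < K) sequentially"
    using dyadic_passage_tendsto[OF K] less by (rule order_tendstoD)
  then have "eventually (\<lambda>m. l \<le> f (dyadic_passage f l K m)) sequentially"
  proof eventually_elim
    case (elim m)
    have "passage_index (\<lambda>i. f (real i * (K / 2 ^ m))) l (2 ^ m) < 2 ^ m"
    proof (rule ccontr)
      assume "\<not> ?thesis"
      then have "passage_index (\<lambda>i. f (real i * (K / 2 ^ m))) l (2 ^ m) = 2 ^ m"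
        by (meson le_neq_implies_less passage_index_le)
      then show False using elim by (simp add: dyadic_passage_def)
    qed
    from passage_index_reaches[OF this] show ?case by (simp add: dyadic_passage_def)
  qed
  moreover have "(\<lambda>m. f (dyadic_passage f l K m)) \<longlonglongrightarrow> f (passage_time f l K)"
    by (rule continuous_on_tendsto_compose[OF f(1) dyadic_passage_tendsto[OF K]])
       (use passage_time_bounds[OF K] dyadic_passage_bounds[OF K] in auto)
  ultimately show "l \<le> f (passage_time f l K)"
    by (intro tendsto_lowerbound) auto
qed

text \<open>
  Levels strictly below \<open>1\<close>: a path that reaches \<open>1\<close> is above such a level on a whole interval
  before, so that fine grids notice the passage. A grid would miss a path that merely touches \<open>1\<close>.
\<close>

definition level_seq :: "nat \<Rightarrow> real" where "level_seq n = 1 - 1 / (real n + 2)"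

lemma level_seq_bounds: "0 < level_seq n" "level_seq n < 1" "level_seq \<longlonglongrightarrow> 1"
proof -
  show "0 < level_seq n" "level_seq n < 1" by (auto simp: level_seq_def field_simps)
  show "level_seq \<longlonglongrightarrow> 1" unfolding level_seq_def by real_asymp
qed

lemma passage_times_below_hit:
  assumes f: "continuous_on {0..} f" "f 0 = 0" and t: "0 \<le> t" "f t = 1"
  shows "passage_time f (level_seq n) (real n + 1) \<le> t"
  using le_level_before_passage_time[of "real n + 1" f "level_seq n" t] f t level_seq_bounds(1,2)[of n]
  by force

text \<open>
  On a compact time interval without a visit to \<open>1\<close> the path stays below some constant less
  than \<open>1\<close>, hence below all but finitely many of the levels. Together with
  \<open>passage_times_below_hit\<close> this gives convergence to the hitting time, finite or infinite.
\<close>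

lemma passage_times_exceed:
  assumes f: "continuous_on {0..} f" "f 0 = 0" and R: "0 \<le> R" "\<And>s. 0 \<le> s \<Longrightarrow> s \<le> R \<Longrightarrow> f s \<noteq> 1"
  shows "eventually (\<lambda>n. R < passage_time f (level_seq n) (real n + 1)) sequentially"
proof -
  have cont: "continuous_on {0..R} f" by (rule continuous_on_subset[OF f(1)]) auto
  obtain x where x: "x \<in> {0..R}" "\<And>s. s \<in> {0..R} \<Longrightarrow> f s \<le> f x"
    using continuous_attains_sup[OF _ _ cont] R(1) by auto
  \<comment> \<open>a value above \<open>1\<close> would force a visit to \<open>1\<close> by the intermediate value theorem\<close>
  have "f x < 1"
  proof (rule ccontr)
    assume "\<not> f x < 1"
    moreover have "continuous_on {0..x} f"
      using x(1) by (intro continuous_on_subset[OF cont]) auto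
    ultimately obtain s where "0 \<le> s" "s \<le> x" "f s = 1"
      using IVT'[of f 0 1 x] f(2) x(1) by auto
    then show False using R(2)[of s] x(1) by auto
  qed
  then have "eventually (\<lambda>n. f x < level_seq n) sequentially"
    using level_seq_bounds(3) by (rule order_tendstoD(1)[rotated])
  moreover have "eventually (\<lambda>n. R < real n + 1) sequentially"
    by real_asymp
  ultimately show ?thesis
  proof eventually_elim
    case (elim n)
    show ?case
    proof (rule ccontr)
      assume le: "\<not> ?thesis"
      have "f (passage_time f (level_seq n) (real n + 1)) = level_seq n"
        by (rule passage_time_reaches) (use f le elim level_seq_bounds(1,2)[of n] in auto)
      moreover have "passage_time f (level_seq n) (real n + 1) \<in> {0..R}"
        using le passage_time_bounds(1)[of "real n + 1" f "level_seq n"] by simp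
      ultimately show False using x(2) elim(1) by force
    qed
  qed
qed

section \<open>Measurability of hitting times and of integrals along paths\<close>

lemma hitting_time_infinite:
  assumes "hitting_time B a \<omega> = \<infinity>" "0 \<le> s" shows "B s \<omega> \<noteq> a"
proof
  assume "B s \<omega> = a"
  then have "hitting_time B a \<omega> \<le> ennreal s"
    unfolding hitting_time_def using assms(2) by (intro INF_lower) simp
  then show False using assms(1) by (simp add: top_unique)
qed

text \<open>
  The set of times at which a continuous path is \<open>a\<close> is closed, so the infimum is attained.
\<close>

lemma hitting_time_finite:
  assumes cont: "continuous_on {0..} (\<lambda>t. B t \<omega>)" and fin: "hitting_time B a \<omega> \<noteq> \<infinity>"
  shows "B (enn2real (hitting_time B a \<omega>)) \<omega> = a"
    "\<And>s. 0 \<le> s \<Longrightarrow> s < enn2real (hitting_time B a \<omega>) \<Longrightarrow> B s \<omega> \<noteq> a"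
proof -
  define A where "A = {t. 0 \<le> t \<and> B t \<omega> = a}"
  have ne: "A \<noteq> {}" using fin by (auto simp: hitting_time_def A_def)
  have bdd: "bdd_below A" by (auto simp: A_def bdd_below_def)
  have "closed ({0..} \<inter> (\<lambda>t. B t \<omega>) -` {a})"
    by (intro continuous_closed_preimage cont) auto
  also have "{0..} \<inter> (\<lambda>t. B t \<omega>) -` {a} = A" by (auto simp: A_def)
  finally have Inf: "Inf A \<in> A" by (rule closed_contains_Inf[OF ne bdd])
  have "hitting_time B a \<omega> = (INF t\<in>A. ennreal t)" by (simp add: hitting_time_def A_def)
  also have "\<dots> = ennreal (Inf A)"
    by (intro antisym INF_lower INF_greatest ennreal_leI cInf_lower Inf bdd)
  finally have eq: "enn2real (hitting_time B a \<omega>) = Inf A"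
    using Inf by (simp add: A_def)
  show "B (enn2real (hitting_time B a \<omega>)) \<omega> = a" using Inf by (simp add: eq A_def)
  fix s assume "0 \<le> s" "s < enn2real (hitting_time B a \<omega>)"
  then show "B s \<omega> \<noteq> a" using cInf_lower[OF _ bdd, of s] by (auto simp: eq A_def)
qed

text \<open>
  By compactness, a continuous path takes the value \<open>a\<close> in \<open>[0, r]\<close> iff it comes arbitrarily close to
  \<open>a\<close> at rational times there. This is a countable condition.
\<close>

lemma measurable_hitting_time:
  assumes B: "\<And>t. 0 \<le> t \<Longrightarrow> B t \<in> borel_measurable M"
    and cont: "\<And>\<omega>. \<omega> \<in> space M \<Longrightarrow> continuous_on {0..} (\<lambda>t. B t \<omega>)"
  shows "hitting_time B a \<in> borel_measurable M"
proof (rule borel_measurableI_le)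
  fix y :: ennreal
  show "{\<omega> \<in> space M. hitting_time B a \<omega> \<le> y} \<in> sets M"
  proof (cases y)
    case top then show ?thesis by simp
  next
    case (real r)
    have iff: "hitting_time B a \<omega> \<le> y \<longleftrightarrow> (\<forall>n::nat. \<exists>q\<in>\<rat> \<inter> {0..r}. \<bar>B q \<omega> - a\<bar> < 1 / (real n + 1))"
      if \<omega>: "\<omega> \<in> space M" for \<omega>
    proof
      assume le: "hitting_time B a \<omega> \<le> y"
      define s where "s = enn2real (hitting_time B a \<omega>)"
      have fin: "hitting_time B a \<omega> \<noteq> \<infinity>" using le real by (auto simp: top_unique)
      have s: "0 \<le> s" "s \<le> r" "B s \<omega> = a"
        using hitting_time_finite(1)[OF cont[OF \<omega>] fin] le real fin
        by (auto simp: s_def enn2real_leI)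
      define d where "d m = real (nat \<lfloor>s / (1 / real (Suc m))\<rfloor>) * (1 / real (Suc m))" for m
      have d: "d m \<le> s" "d \<longlonglongrightarrow> s" for m
        using grid_point_tendsto[OF s(1), of "\<lambda>m. 1 / real (Suc m)"] LIMSEQ_inverse_real_of_nat
        by (simp_all add: d_def[abs_def] inverse_eq_divide)
      have d_Rats: "d m \<in> \<rat> \<inter> {0..r}" for m
        using d(1)[of m] s by (auto simp: d_def intro!: Rats_mult Rats_divide mult_nonneg_nonneg)
      have lim: "(\<lambda>m. B (d m) \<omega>) \<longlonglongrightarrow> a"
        using continuous_on_tendsto_compose[OF cont[OF \<omega>] d(2)] s d_Rats by auto
      show "\<forall>n::nat. \<exists>q\<in>\<rat> \<inter> {0..r}. \<bar>B q \<omega> - a\<bar> < 1 / (real n + 1)"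
      proof
        fix n :: nat
        obtain m where "\<bar>B (d m) \<omega> - a\<bar> < 1 / (real n + 1)"
          using LIMSEQ_D[OF lim, of "1 / (real n + 1)"] by auto
        then show "\<exists>q\<in>\<rat> \<inter> {0..r}. \<bar>B q \<omega> - a\<bar> < 1 / (real n + 1)"
          using d_Rats by blast
      qed
    next
      assume near: "\<forall>n::nat. \<exists>q\<in>\<rat> \<inter> {0..r}. \<bar>B q \<omega> - a\<bar> < 1 / (real n + 1)"
      have "continuous_on {0..r} (\<lambda>t. B t \<omega>)"
        by (rule continuous_on_subset[OF cont[OF \<omega>]]) auto
      then have "continuous_on {0..r} (\<lambda>t. \<bar>B t \<omega> - a\<bar>)"
        by (intro continuous_intros)
      from continuous_attains_inf[OF _ _ this] real obtain s where s: "s \<in> {0..r}"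
        "\<And>q. q \<in> {0..r} \<Longrightarrow> \<bar>B s \<omega> - a\<bar> \<le> \<bar>B q \<omega> - a\<bar>" by auto
      have "\<bar>B s \<omega> - a\<bar> \<le> 1 / (real n + 1)" for n :: nat
        using near s(2) by (meson IntE le_less_trans less_imp_le)
      moreover have "(\<lambda>n. 1 / (real n + 1)) \<longlonglongrightarrow> 0"
        using LIMSEQ_inverse_real_of_nat by (simp add: inverse_eq_divide add.commute)
      ultimately have "\<bar>B s \<omega> - a\<bar> \<le> 0"
        by (intro LIMSEQ_le_const) auto
      then have "hitting_time B a \<omega> \<le> ennreal s"
        unfolding hitting_time_def using s(1) by (intro INF_lower) simp
      then show "hitting_time B a \<omega> \<le> y"
        using s(1) real by (auto intro: order_trans ennreal_leI)
    qed
    have [measurable]: "B q \<in> borel_measurable M" if "q \<in> \<rat> \<inter> {0..r}" for q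
      using B that by auto
    have "countable (\<rat> \<inter> {0..r})" using countable_rat by blast
    then have "{\<omega> \<in> space M. \<forall>n::nat. \<exists>q\<in>\<rat> \<inter> {0..r}. \<bar>B q \<omega> - a\<bar> < 1 / (real n + 1)} \<in> sets M"
      by (intro sets.sets_Collect_countable_All sets.sets_Collect_countable_Bex) measurable
    then show ?thesis using iff by (simp cong: conj_cong)
  qed
qed

text \<open>
  The process is the limit of its left-point discretizations, which are jointly measurable because
  they involve countably many marginals. The \<open>max\<close> extends the paths constantly to negative times,
  where nothing is known about them.
\<close>

lemma measurable_continuous_process:
  fixes Z :: "real \<Rightarrow> 'a \<Rightarrow> real"
  assumes Z: "\<And>t. 0 \<le> t \<Longrightarrow> Z t \<in> borel_measurable M"
    and cont: "\<And>\<omega>. \<omega> \<in> space M \<Longrightarrow> continuous_on {0..} (\<lambda>t. Z t \<omega>)"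
  shows "(\<lambda>(\<omega>, s). Z (max 0 s) \<omega>) \<in> borel_measurable (M \<Otimes>\<^sub>M lborel)"
proof (rule borel_measurable_LIMSEQ_real)
  define f where "f m x = Z (real (nat \<lfloor>max 0 (snd x) / (1 / real (Suc m))\<rfloor>) * (1 / real (Suc m))) (fst x)"
    for m and x :: "'a \<times> real"
  show "f m \<in> borel_measurable (M \<Otimes>\<^sub>M lborel)" for m
    unfolding f_def
  proof (rule measurable_compose_countable[where f = "\<lambda>i x. Z (real i * (1 / real (Suc m))) (fst x)"])
    show "(\<lambda>x. Z (real i * (1 / real (Suc m))) (fst x)) \<in> borel_measurable (M \<Otimes>\<^sub>M lborel)" for i
      by (rule measurable_compose[OF measurable_fst Z]) simp
  qed measurable
  fix x :: "'a \<times> real" assume "x \<in> space (M \<Otimes>\<^sub>M lborel)"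
  then have \<omega>: "fst x \<in> space M" by (auto simp: space_pair_measure)
  have "(\<lambda>m. real (nat \<lfloor>max 0 (snd x) / (1 / real (Suc m))\<rfloor>) * (1 / real (Suc m))) \<longlonglongrightarrow> max 0 (snd x)"
    using grid_point_tendsto(2)[of "max 0 (snd x)" "\<lambda>m. 1 / real (Suc m)"] LIMSEQ_inverse_real_of_nat
    by (simp add: inverse_eq_divide)
  from continuous_on_tendsto_compose[OF cont[OF \<omega>] this]
  show "(\<lambda>m. f m x) \<longlonglongrightarrow> (case x of (\<omega>, s) \<Rightarrow> Z (max 0 s) \<omega>)"
    by (auto simp: f_def split_beta)
qed

lemma measurable_path_integral:
  fixes Z :: "real \<Rightarrow> 'a \<Rightarrow> real"
  assumes Z: "\<And>t. 0 \<le> t \<Longrightarrow> Z t \<in> borel_measurable M"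
    and cont: "\<And>\<omega>. \<omega> \<in> space M \<Longrightarrow> continuous_on {0..} (\<lambda>t. Z t \<omega>)"
    and \<tau>[measurable]: "\<tau> \<in> borel_measurable M"
  shows "(\<lambda>\<omega>. LBINT s:{0..\<tau> \<omega>}. Z s \<omega>) \<in> borel_measurable M"
proof -
  note [measurable] = measurable_continuous_process[OF Z cont]
  have "(LBINT s:{0..\<tau> \<omega>}. Z s \<omega>) = (LBINT s. (if 0 \<le> s \<and> s \<le> \<tau> \<omega> then 1 else 0) * Z (max 0 s) \<omega>)" for \<omega>
    unfolding set_lebesgue_integral_def
    by (intro Bochner_Integration.integral_cong) (auto simp: indicator_def)
  moreover have "(\<lambda>\<omega>. LBINT s. (if 0 \<le> s \<and> s \<le> \<tau> \<omega> then 1 else 0) * Z (max 0 s) \<omega>) \<in> borel_measurable M"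
    by measurable
  ultimately show ?thesis by simp
qed

section \<open>Limits of expectations\<close>

lemma nn_integral_le_of_liminf:
  fixes f :: "nat \<Rightarrow> 'a \<Rightarrow> ennreal"
  assumes [measurable]: "\<And>n. f n \<in> borel_measurable M"
    and g: "\<And>x. x \<in> space M \<Longrightarrow> g x \<le> liminf (\<lambda>n. f n x)"
    and C: "\<And>n. (\<integral>\<^sup>+x. f n x \<partial>M) \<le> ennreal (C n)" "C \<longlonglongrightarrow> L"
  shows "(\<integral>\<^sup>+x. g x \<partial>M) \<le> ennreal L"
proof -
  have "(\<integral>\<^sup>+x. g x \<partial>M) \<le> (\<integral>\<^sup>+x. liminf (\<lambda>n. f n x) \<partial>M)"
    by (intro nn_integral_mono g)
  also have "\<dots> \<le> liminf (\<lambda>n. \<integral>\<^sup>+x. f n x \<partial>M)"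
    by (intro nn_integral_liminf) simp
  also have "\<dots> \<le> liminf (\<lambda>n. ennreal (C n))"
    using C(1) by (intro Liminf_mono always_eventually allI)
  also have "\<dots> = ennreal L"
    by (intro lim_imp_Liminf tendsto_ennrealI C(2)) auto
  finally show ?thesis .
qed

lemma nn_integral_le_of_tendsto:
  fixes f :: "nat \<Rightarrow> 'a \<Rightarrow> real"
  assumes lim: "\<And>x. x \<in> space M \<Longrightarrow> (\<lambda>n. f n x) \<longlonglongrightarrow> g x"
    and f: "\<And>n x. x \<in> space M \<Longrightarrow> 0 \<le> f n x" "\<And>n. integrable M (f n)"
    and C: "\<And>n. (\<integral>x. f n x \<partial>M) \<le> C n" "C \<longlonglongrightarrow> L"
  shows "(\<integral>\<^sup>+x. ennreal (g x) \<partial>M) \<le> ennreal L"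
proof (rule nn_integral_le_of_liminf[where f = "\<lambda>n x. ennreal (f n x)", OF _ _ _ C(2)])
  have [measurable]: "f n \<in> borel_measurable M" for n
    using f(2) by blast
  show "(\<lambda>x. ennreal (f n x)) \<in> borel_measurable M" for n
    by measurable
  show "ennreal (g x) \<le> liminf (\<lambda>n. ennreal (f n x))" if "x \<in> space M" for x
    using lim_imp_Liminf[OF _ tendsto_ennrealI[OF lim[OF that]]] by simp
  show "(\<integral>\<^sup>+x. ennreal (f n x) \<partial>M) \<le> ennreal (C n)" for n
    using f C(1)[of n] by (subst nn_integral_eq_integral) (auto intro: ennreal_leI)
qed

text \<open>
  A bound in \<open>L\<^sup>2\<close> gives uniform integrability: cutting off at \<open>R\<close> changes the expectations by at most
  \<open>C / R\<close>, and for the truncated variables bounded convergence applies. This is how the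
  overshoot of the grid walk over the level, which has no pointwise bound, is kept under control.
\<close>

lemma (in prob_space) expectation_tendsto_L2_bounded:
  fixes f :: "nat \<Rightarrow> 'a \<Rightarrow> real"
  assumes lim: "\<And>x. x \<in> space M \<Longrightarrow> (\<lambda>n. f n x) \<longlonglongrightarrow> g x"
    and nonneg: "\<And>n x. x \<in> space M \<Longrightarrow> 0 \<le> f n x"
    and meas[measurable]: "\<And>n. f n \<in> borel_measurable M"
    and sq: "\<And>n. integrable M (\<lambda>x. (f n x)\<^sup>2)" "\<And>n. expectation (\<lambda>x. (f n x)\<^sup>2) \<le> C"
  shows "integrable M g" "(\<lambda>n. expectation (f n)) \<longlonglongrightarrow> expectation g"
proof -
  have [measurable]: "g \<in> borel_measurable M"
    by (rule borel_measurable_LIMSEQ_real[OF lim]) auto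
  have g_nonneg: "0 \<le> g x" if "x \<in> space M" for x
    using lim[OF that] nonneg[OF that] by (blast intro: LIMSEQ_le_const)
  have "0 \<le> expectation (\<lambda>x. (f 0 x)\<^sup>2)" by simp
  then have C: "0 \<le> C" using sq(2)[of 0] by linarith
  have "(\<integral>\<^sup>+x. ennreal ((g x)\<^sup>2) \<partial>M) \<le> ennreal C"
    by (rule nn_integral_le_of_tendsto[where f = "\<lambda>n x. (f n x)\<^sup>2" and C = "\<lambda>_. C"])
       (use sq in \<open>auto intro!: tendsto_power lim\<close>)
  then have g_sq: "integrable M (\<lambda>x. (g x)\<^sup>2)" "expectation (\<lambda>x. (g x)\<^sup>2) \<le> C"
    using C by (auto intro!: integrableI_bounded integral_real_bounded simp: le_less_trans less_top[symmetric] top_unique)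
  have int: "integrable M (f n)" "integrable M g" for n
    using sq(1)[of n] g_sq(1) by (auto intro: square_integrable_imp_integrable)
  show "integrable M g" by fact
  have trunc: "\<bar>expectation u - expectation (\<lambda>x. min (u x) R)\<bar> \<le> C / R"
    if R: "0 < R" and u: "integrable M u" "\<And>x. x \<in> space M \<Longrightarrow> 0 \<le> u x"
      "integrable M (\<lambda>x. (u x)\<^sup>2)" "expectation (\<lambda>x. (u x)\<^sup>2) \<le> C" for u R
  proof -
    have min_int: "integrable M (\<lambda>x. min (u x) R)" using u(1) by simp
    have "expectation u - expectation (\<lambda>x. min (u x) R) = expectation (\<lambda>x. u x - min (u x) R)"
      using u(1) min_int by simp
    moreover have "expectation (\<lambda>x. u x - min (u x) R) \<le> expectation (\<lambda>x. (u x)\<^sup>2 / R)"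
    proof (rule integral_mono)
      fix x assume x: "x \<in> space M"
      show "u x - min (u x) R \<le> (u x)\<^sup>2 / R"
      proof (cases "u x \<le> R")
        case True then show ?thesis using R by simp
      next
        case False
        then have "u x * R \<le> u x * u x" using R by (intro mult_left_mono) auto
        then have "u x \<le> (u x)\<^sup>2 / R" using R by (simp add: field_simps power2_eq_square)
        then show ?thesis using False R by simp
      qed
    qed (use u min_int in auto)
    moreover have "expectation (\<lambda>x. (u x)\<^sup>2 / R) \<le> C / R"
      using u(4) R by (simp add: divide_right_mono)
    moreover have "0 \<le> expectation (\<lambda>x. u x - min (u x) R)"
      by (intro Bochner_Integration.integral_nonneg) simp
    ultimately show ?thesis by simp
  qed
  show "(\<lambda>n. expectation (f n)) \<longlonglongrightarrow> expectation g"
  proof (rule LIMSEQ_I)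
    fix r :: real assume r: "0 < r"
    \<comment> \<open>both truncation errors are then at most \<open>r / 4\<close>\<close>
    define R where "R = 4 * (C + 1) / r"
    have R: "0 < R" "C / R \<le> r / 4" using r C by (auto simp: R_def field_simps)
    have "(\<lambda>n. expectation (\<lambda>x. min (f n x) R)) \<longlonglongrightarrow> expectation (\<lambda>x. min (g x) R)"
    proof (rule integral_dominated_convergence[where w = "\<lambda>_. R"])
      show "AE x in M. (\<lambda>n. min (f n x) R) \<longlonglongrightarrow> min (g x) R"
        by (auto intro!: AE_I2 tendsto_min lim)
      show "AE x in M. norm (min (f n x) R) \<le> R" for n
        using nonneg R by (auto intro!: AE_I2)
    qed auto
    from LIMSEQ_D[OF this, of "r / 4"] r obtain n0 where n0:
      "\<And>n. n0 \<le> n \<Longrightarrow> \<bar>expectation (\<lambda>x. min (f n x) R) - expectation (\<lambda>x. min (g x) R)\<bar> < r / 4"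
      by auto
    have "norm (expectation (f n) - expectation g) < r" if "n0 \<le> n" for n
    proof -
      have 1: "\<bar>expectation (f n) - expectation (\<lambda>x. min (f n x) R)\<bar> \<le> C / R"
        by (rule trunc[OF R(1) int(1)]) (use nonneg sq in auto)
      have 2: "\<bar>expectation g - expectation (\<lambda>x. min (g x) R)\<bar> \<le> C / R"
        by (rule trunc[OF R(1) int(2)]) (use g_nonneg g_sq in auto)
      show ?thesis
        using 1 2 n0[OF that] R(2) r unfolding real_norm_def by linarith
    qed
    then show "\<exists>n0. \<forall>n\<ge>n0. norm (expectation (f n) - expectation g) < r" by blast
  qed
qed

section \<open>Optional stopping on a grid\<close>

text \<open>
  Stopping one step later changes the stopped value by the increment of \<open>Y\<close>, on the event that
  the level has not been reached so far. For a martingale this event is known before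
  the increment, whence the hypothesis.
\<close>

lemma (in prob_space) optional_stopping:
  fixes X Y :: "nat \<Rightarrow> 'a \<Rightarrow> real"
  assumes Y: "integrable M (Y 0)"
    and incr: "\<And>i. integrable M (\<lambda>\<omega>. if \<forall>j\<in>{..i}. X j \<omega> < l then Y (Suc i) \<omega> - Y i \<omega> else 0)"
      "\<And>i. expectation (\<lambda>\<omega>. if \<forall>j\<in>{..i}. X j \<omega> < l then Y (Suc i) \<omega> - Y i \<omega> else 0) = 0"
  shows "integrable M (\<lambda>\<omega>. Y (passage_index (\<lambda>i. X i \<omega>) l n) \<omega>)"
    "expectation (\<lambda>\<omega>. Y (passage_index (\<lambda>i. X i \<omega>) l n) \<omega>) = expectation (Y 0)"
proof (induction n)
  case 0
  have "passage_index x l 0 = 0" for x :: "nat \<Rightarrow> real"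
    using passage_index_le[of x l 0] by simp
  then show "integrable M (\<lambda>\<omega>. Y (passage_index (\<lambda>i. X i \<omega>) l 0) \<omega>)"
    "expectation (\<lambda>\<omega>. Y (passage_index (\<lambda>i. X i \<omega>) l 0) \<omega>) = expectation (Y 0)"
    using Y by simp_all
next
  case (Suc n)
  have "Y (passage_index (\<lambda>i. X i \<omega>) l (Suc n)) \<omega> = Y (passage_index (\<lambda>i. X i \<omega>) l n) \<omega>
      + (if \<forall>j\<in>{..n}. X j \<omega> < l then Y (Suc n) \<omega> - Y n \<omega> else 0)" for \<omega>
    using passage_index_eq[of n "\<lambda>i. X i \<omega>" l] by (auto simp: passage_index_Suc)
  then show "integrable M (\<lambda>\<omega>. Y (passage_index (\<lambda>i. X i \<omega>) l (Suc n)) \<omega>)"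
    "expectation (\<lambda>\<omega>. Y (passage_index (\<lambda>i. X i \<omega>) l (Suc n)) \<omega>) = expectation (Y 0)"
    using Suc incr[of n] by simp_all
qed

lemma (in prob_space) normal_exponential_moment:
  assumes X: "distributed M lborel X (normal_density 0 s)" and s: "0 < s"
  shows "integrable M (\<lambda>\<omega>. exp (u * X \<omega>))" "expectation (\<lambda>\<omega>. exp (u * X \<omega>)) = exp (u\<^sup>2 * s\<^sup>2 / 2)"
proof -
  have eq: "normal_density 0 s x * exp (u * x) = exp (u\<^sup>2 * s\<^sup>2 / 2) * normal_density (u * s\<^sup>2) s x" for x
  proof -
    have "- (x - 0)\<^sup>2 / (2 * s\<^sup>2) + u * x = u\<^sup>2 * s\<^sup>2 / 2 + (- (x - u * s\<^sup>2)\<^sup>2 / (2 * s\<^sup>2))"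
      using s by (simp add: field_simps power2_eq_square)
    then have "exp (- (x - 0)\<^sup>2 / (2 * s\<^sup>2)) * exp (u * x) = exp (u\<^sup>2 * s\<^sup>2 / 2) * exp (- (x - u * s\<^sup>2)\<^sup>2 / (2 * s\<^sup>2))"
      by (metis exp_add)
    then show ?thesis by (simp add: normal_density_def)
  qed
  have "integrable lborel (\<lambda>x. normal_density 0 s x * exp (u * x))"
    unfolding eq using integrable_normal_density[OF s] by simp
  then show "integrable M (\<lambda>\<omega>. exp (u * X \<omega>))"
    by (subst (asm) distributed_integrable[OF X]) auto
  have "expectation (\<lambda>\<omega>. exp (u * X \<omega>)) = (\<integral>x. normal_density 0 s x * exp (u * x) \<partial>lborel)"
    by (subst distributed_integral[OF X]) auto
  then show "expectation (\<lambda>\<omega>. exp (u * X \<omega>)) = exp (u\<^sup>2 * s\<^sup>2 / 2)"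
    unfolding eq using integral_normal_density[OF s] by simp
qed

text \<open>
  Vanishing at time \<open>0\<close> for every path, not just almost every one, makes the
  values on a grid functions of the increments.
\<close>

locale brownian_motion_from_0 = standard_brownian_motion M W
  for M :: "'a measure" and W +
  assumes W_0: "\<And>\<omega>. \<omega> \<in> space M \<Longrightarrow> W 0 \<omega> = 0"

begin

lemma increment_exponential_moment:
  assumes "0 \<le> s" "s \<le> t"
  shows "integrable M (\<lambda>\<omega>. exp (u * (W t \<omega> - W s \<omega>)))"
    "expectation (\<lambda>\<omega>. exp (u * (W t \<omega> - W s \<omega>))) = exp (u\<^sup>2 * (t - s) / 2)"
proof -
  have "integrable M (\<lambda>\<omega>. exp (u * (W t \<omega> - W s \<omega>))) \<and>
    expectation (\<lambda>\<omega>. exp (u * (W t \<omega> - W s \<omega>))) = exp (u\<^sup>2 * (t - s) / 2)"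
  proof (cases "s = t")
    case True then show ?thesis by (simp add: prob_space)
  next
    case False
    then show ?thesis
      using normal_exponential_moment[OF normal_increments, of s t u] assms by simp
  qed
  then show "integrable M (\<lambda>\<omega>. exp (u * (W t \<omega> - W s \<omega>)))"
    "expectation (\<lambda>\<omega>. exp (u * (W t \<omega> - W s \<omega>))) = exp (u\<^sup>2 * (t - s) / 2)" by auto
qed

lemma exponential_moment_integrable:
  assumes "0 \<le> t" shows "integrable M (\<lambda>\<omega>. exp (u * W t \<omega>))"
  using increment_exponential_moment(1)[of 0 t u] assms W_0
  by (subst Bochner_Integration.integrable_cong[where g = "\<lambda>\<omega>. exp (u * (W t \<omega> - W 0 \<omega>))"]) auto

lemma measurable_grid_path:
  assumes "0 < h"
  shows "(\<lambda>\<omega>. \<lambda>j\<in>{..i}. W (real j * h) \<omega>) \<in> M \<rightarrow>\<^sub>M PiM {..i} (\<lambda>_::nat. borel)"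
  using assms by (intro measurable_restrict random_variable_at) auto

text \<open>
  The values up to index \<open>i\<close> are partial sums of the first \<open>i\<close> increments, and these are independent
  of the next one.
\<close>

lemma past_indep_increment:
  fixes u :: "(nat \<Rightarrow> real) \<Rightarrow> real"
  assumes h: "0 < h" and u: "u \<in> borel_measurable (PiM {..i} (\<lambda>_. borel))"
    and g: "g \<in> borel_measurable borel"
    and U: "integrable M (\<lambda>\<omega>. u (\<lambda>j\<in>{..i}. W (real j * h) \<omega>))"
    and G: "integrable M (\<lambda>\<omega>. g (W (real (Suc i) * h) \<omega> - W (real i * h) \<omega>))"
  shows "integrable M (\<lambda>\<omega>. u (\<lambda>j\<in>{..i}. W (real j * h) \<omega>) * g (W (real (Suc i) * h) \<omega> - W (real i * h) \<omega>))"
    "expectation (\<lambda>\<omega>. u (\<lambda>j\<in>{..i}. W (real j * h) \<omega>) * g (W (real (Suc i) * h) \<omega> - W (real i * h) \<omega>))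
      = expectation (\<lambda>\<omega>. u (\<lambda>j\<in>{..i}. W (real j * h) \<omega>))
        * expectation (\<lambda>\<omega>. g (W (real (Suc i) * h) \<omega> - W (real i * h) \<omega>))"
proof -
  define \<xi> where "\<xi> j \<omega> = W (real (Suc j) * h) \<omega> - W (real j * h) \<omega>" for j :: nat and \<omega>
  define Y :: "(nat \<Rightarrow> real) \<Rightarrow> nat \<Rightarrow> real" where "Y v = (\<lambda>j\<in>{..i}. \<Sum>k<j. v k)" for v
  have "indep_vars (\<lambda>_. borel) \<xi> {..<Suc i}"
    unfolding \<xi>_def using h by (intro indep_increments) (auto intro!: mono_onI mult_right_mono)
  then have "indep_var (PiM {..<i} (\<lambda>_. borel)) (\<lambda>\<omega>. restrict (\<lambda>j. \<xi> j \<omega>) {..<i})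
      (PiM {i} (\<lambda>_. borel)) (\<lambda>\<omega>. restrict (\<lambda>j. \<xi> j \<omega>) {i})"
    by (rule indep_var_restrict) auto
  moreover have "Y \<in> PiM {..<i} (\<lambda>_. borel) \<rightarrow>\<^sub>M PiM {..i} (\<lambda>_. borel)"
    unfolding Y_def
    by (intro measurable_restrict borel_measurable_sum measurable_component_singleton) auto
  then have "(\<lambda>v. u (Y v)) \<in> borel_measurable (PiM {..<i} (\<lambda>_. borel))"
    using u by (rule measurable_compose)
  moreover have "(\<lambda>v. g (v i)) \<in> borel_measurable (PiM {i} (\<lambda>_. borel))"
    using g by (rule measurable_compose[rotated]) (simp add: measurable_component_singleton)
  ultimately have indep: "indep_var borel ((\<lambda>v. u (Y v)) \<circ> (\<lambda>\<omega>. restrict (\<lambda>j. \<xi> j \<omega>) {..<i}))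
      borel ((\<lambda>v. g (v i)) \<circ> (\<lambda>\<omega>. restrict (\<lambda>j. \<xi> j \<omega>) {i}))"
    by (rule indep_var_compose)
  have "(\<Sum>k<j. \<xi> k \<omega>) = W (real j * h) \<omega>" if "\<omega> \<in> space M" for j \<omega>
    unfolding \<xi>_def using sum_lessThan_telescope[of "\<lambda>k. W (real k * h) \<omega>" j] W_0[OF that] by simp
  then have "Y (restrict (\<lambda>j. \<xi> j \<omega>) {..<i}) = (\<lambda>j\<in>{..i}. W (real j * h) \<omega>)" if "\<omega> \<in> space M" for \<omega>
    using that by (auto simp: Y_def fun_eq_iff)
  then have eq1: "((\<lambda>v. u (Y v)) \<circ> (\<lambda>\<omega>. restrict (\<lambda>j. \<xi> j \<omega>) {..<i})) \<omega> = u (\<lambda>j\<in>{..i}. W (real j * h) \<omega>)"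
    if "\<omega> \<in> space M" for \<omega>
    using that by simp
  have eq2: "((\<lambda>v. g (v i)) \<circ> (\<lambda>\<omega>. restrict (\<lambda>j. \<xi> j \<omega>) {i})) \<omega> = g (W (real (Suc i) * h) \<omega> - W (real i * h) \<omega>)" for \<omega>
    by (simp add: \<xi>_def)
  have int: "integrable M ((\<lambda>v. u (Y v)) \<circ> (\<lambda>\<omega>. restrict (\<lambda>j. \<xi> j \<omega>) {..<i}))"
    "integrable M ((\<lambda>v. g (v i)) \<circ> (\<lambda>\<omega>. restrict (\<lambda>j. \<xi> j \<omega>) {i}))"
    by (simp_all only: eq1 eq2 U G cong: Bochner_Integration.integrable_cong)
  show "integrable M (\<lambda>\<omega>. u (\<lambda>j\<in>{..i}. W (real j * h) \<omega>) * g (W (real (Suc i) * h) \<omega> - W (real i * h) \<omega>))"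
    using indep_var_integrable[OF indep int]
    by (simp only: eq1 eq2 cong: Bochner_Integration.integrable_cong)
  show "expectation (\<lambda>\<omega>. u (\<lambda>j\<in>{..i}. W (real j * h) \<omega>) * g (W (real (Suc i) * h) \<omega> - W (real i * h) \<omega>))
      = expectation (\<lambda>\<omega>. u (\<lambda>j\<in>{..i}. W (real j * h) \<omega>))
        * expectation (\<lambda>\<omega>. g (W (real (Suc i) * h) \<omega> - W (real i * h) \<omega>))"
    using indep_var_lebesgue_integral[OF indep int]
    by (simp only: eq1 eq2 cong: Bochner_Integration.integral_cong)
qed

definition grid_passage :: "real \<Rightarrow> real \<Rightarrow> nat \<Rightarrow> 'a \<Rightarrow> nat" where
  "grid_passage h l n \<omega> = passage_index (\<lambda>i. W (real i * h) \<omega>) l n"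

lemma measurable_grid_passage:
  assumes "0 < h" shows "grid_passage h l n \<in> M \<rightarrow>\<^sub>M count_space UNIV"
proof -
  have [measurable]: "W (real i * h) \<in> borel_measurable M" for i :: nat
    using assms by (intro random_variable_at) simp
  show ?thesis unfolding grid_passage_def passage_index_def by measurable
qed

lemma measurable_grid_stopped:
  assumes h: "0 < h"
  shows "(\<lambda>\<omega>. W (real (grid_passage h l n \<omega>) * h) \<omega>) \<in> borel_measurable M"
  by (rule measurable_compose_countable[OF _ measurable_grid_passage[OF h]])
     (use h in \<open>intro random_variable_at; simp\<close>)

text \<open>
  As long as the walk is below \<open>l\<close>, the exponential factor is at most \<open>exp (c * l - e)\<close>.
\<close>

lemma integrable_exponential_below_level:
  fixes F :: "(nat \<Rightarrow> real) \<Rightarrow> real" and e l :: real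
  assumes h: "0 < h" and c: "0 \<le> c" and F[measurable]: "F \<in> borel_measurable (PiM {..i} (\<lambda>_. borel))"
    and int: "integrable M (\<lambda>\<omega>. F (\<lambda>j\<in>{..i}. W (real j * h) \<omega>))"
  defines "u \<equiv> \<lambda>v. if \<forall>j\<in>{..i}. v j < l then exp (c * v i - e) * F v else 0"
  shows "u \<in> borel_measurable (PiM {..i} (\<lambda>_. borel))"
    "integrable M (\<lambda>\<omega>. u (\<lambda>j\<in>{..i}. W (real j * h) \<omega>))"
proof -
  have [measurable]: "(\<lambda>v::nat \<Rightarrow> real. v j) \<in> borel_measurable (PiM {..i} (\<lambda>_. borel))" if "j \<in> {..i}" for j
    using that by (rule measurable_component_singleton)
  have [measurable]: "Measurable.pred (PiM {..i} (\<lambda>_. borel)) (\<lambda>v::nat \<Rightarrow> real. \<forall>j\<in>{..i}. v j < l)"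
    by (rule pred_intros_finite) measurable
  have [measurable]: "(\<lambda>v::nat \<Rightarrow> real. v i) \<in> borel_measurable (PiM {..i} (\<lambda>_. borel))"
    by (rule measurable_component_singleton) simp
  show u[measurable]: "u \<in> borel_measurable (PiM {..i} (\<lambda>_. borel))"
    unfolding u_def by measurable
  have bound: "\<bar>u v\<bar> \<le> exp (c * l - e) * \<bar>F v\<bar>" for v
  proof (cases "\<forall>j\<in>{..i}. v j < l")
    case True
    then have "v i \<le> l" by (auto intro: less_imp_le)
    then have "exp (c * v i - e) \<le> exp (c * l - e)" using c by (simp add: mult_left_mono)
    then show ?thesis by (simp add: u_def abs_mult mult_right_mono)
  next
    case False
    then show ?thesis unfolding u_def by (subst if_not_P) auto
  qed
  show "integrable M (\<lambda>\<omega>. u (\<lambda>j\<in>{..i}. W (real j * h) \<omega>))"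
  proof (rule Bochner_Integration.integrable_bound)
    show "integrable M (\<lambda>\<omega>. exp (c * l - e) * \<bar>F (\<lambda>j\<in>{..i}. W (real j * h) \<omega>)\<bar>)"
      using int by simp
    show "(\<lambda>\<omega>. u (\<lambda>j\<in>{..i}. W (real j * h) \<omega>)) \<in> borel_measurable M"
      by (rule measurable_compose[OF measurable_grid_path[OF h] u])
  qed (use bound in auto)
qed

text \<open>
  The exponential martingale \<open>exp (c X\<^sub>i - c\<^sup>2 i h / 2)\<close> of the Gaussian random walk \<open>X\<close>, stopped.
\<close>

lemma stopped_exponential:
  fixes l :: real and n :: nat
  assumes h: "0 < h" and c: "0 \<le> c"
  defines "t \<equiv> \<lambda>\<omega>. real (grid_passage h l n \<omega>) * h"
  shows "integrable M (\<lambda>\<omega>. exp (c * W (t \<omega>) \<omega> - c\<^sup>2 / 2 * t \<omega>))"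
    "expectation (\<lambda>\<omega>. exp (c * W (t \<omega>) \<omega> - c\<^sup>2 / 2 * t \<omega>)) = 1"
proof -
  define Y where "Y i \<omega> = exp (c * W (real i * h) \<omega> - c\<^sup>2 / 2 * (real i * h))" for i :: nat and \<omega>
  define u where "u i v = (if \<forall>j\<in>{..i}. v j < l then exp (c * v i - c\<^sup>2 / 2 * (real i * h)) * 1 else 0)"
    for i :: nat and v :: "nat \<Rightarrow> real"
  define g where "g x = exp (c * x) * exp (- (c\<^sup>2 / 2 * h)) - 1" for x :: real
  have eq: "(if \<forall>j\<in>{..i}. W (real j * h) \<omega> < l then Y (Suc i) \<omega> - Y i \<omega> else 0)
    = u i (\<lambda>j\<in>{..i}. W (real j * h) \<omega>) * g (W (real (Suc i) * h) \<omega> - W (real i * h) \<omega>)" for i \<omega>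
  proof -
    have "Y (Suc i) \<omega> = Y i \<omega> * (exp (c * (W (real (Suc i) * h) \<omega> - W (real i * h) \<omega>)) * exp (- (c\<^sup>2 / 2 * h)))"
      unfolding Y_def exp_add[symmetric] by (simp add: algebra_simps)
    then show ?thesis by (simp add: u_def g_def Y_def algebra_simps)
  qed
  have u: "u i \<in> borel_measurable (PiM {..i} (\<lambda>_. borel))"
    "integrable M (\<lambda>\<omega>. u i (\<lambda>j\<in>{..i}. W (real j * h) \<omega>))" for i
    unfolding u_def by (rule integrable_exponential_below_level[OF h c]; simp)+
  have incr: "integrable M (\<lambda>\<omega>. exp (c * (W (real (Suc i) * h) \<omega> - W (real i * h) \<omega>)))"
    "expectation (\<lambda>\<omega>. exp (c * (W (real (Suc i) * h) \<omega> - W (real i * h) \<omega>))) = exp (c\<^sup>2 * h / 2)" for i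
    using increment_exponential_moment[of "real i * h" "real (Suc i) * h" c] h by (auto simp: algebra_simps)
  have G: "integrable M (\<lambda>\<omega>. g (W (real (Suc i) * h) \<omega> - W (real i * h) \<omega>))" for i
    unfolding g_def using incr(1)[of i] by simp
  have G0: "expectation (\<lambda>\<omega>. g (W (real (Suc i) * h) \<omega> - W (real i * h) \<omega>)) = 0" for i
    unfolding g_def using incr[of i] by (simp add: prob_space exp_minus field_simps)
  have g: "g \<in> borel_measurable borel"
    unfolding g_def by measurable
  note step = past_indep_increment[OF h u(1) g u(2) G]
  have Y0: "integrable M (Y 0)" "expectation (Y 0) = 1"
    using W_0 by (simp_all add: Y_def prob_space cong: Bochner_Integration.integrable_cong Bochner_Integration.integral_cong)
  have "integrable M (\<lambda>\<omega>. Y (passage_index (\<lambda>i. W (real i * h) \<omega>) l n) \<omega>)"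
    "expectation (\<lambda>\<omega>. Y (passage_index (\<lambda>i. W (real i * h) \<omega>) l n) \<omega>) = expectation (Y 0)"
    by (rule optional_stopping[where X = "\<lambda>i. W (real i * h)" and Y = Y];
        simp only: eq step G0 Y0 mult_zero_right)+
  then show "integrable M (\<lambda>\<omega>. exp (c * W (t \<omega>) \<omega> - c\<^sup>2 / 2 * t \<omega>))"
    "expectation (\<lambda>\<omega>. exp (c * W (t \<omega>) \<omega> - c\<^sup>2 / 2 * t \<omega>)) = 1"
    using Y0 by (simp_all add: Y_def t_def grid_passage_def)
qed

text \<open>
  Since the stopping time is at most \<open>n h\<close>, a change of the discount rate costs at most a constant
  factor. With \<open>2 * b\<close> in place of \<open>b\<close> this supplies the \<open>L\<^sup>2\<close> bounds for the passage to the limit.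
\<close>

lemma stopped_exponential_bound:
  fixes l :: real and n :: nat
  assumes h: "0 < h" and b: "0 \<le> b"
  defines "t \<equiv> \<lambda>\<omega>. real (grid_passage h l n \<omega>) * h"
  shows "integrable M (\<lambda>\<omega>. exp (b * W (t \<omega>) \<omega> - \<beta> * t \<omega>))"
    "expectation (\<lambda>\<omega>. exp (b * W (t \<omega>) \<omega> - \<beta> * t \<omega>)) \<le> exp (\<bar>b\<^sup>2 / 2 - \<beta>\<bar> * (real n * h))"
proof -
  let ?C = "exp (\<bar>b\<^sup>2 / 2 - \<beta>\<bar> * (real n * h))"
  have [measurable]: "t \<in> borel_measurable M"
    unfolding t_def using measurable_grid_passage[OF h] by measurable
  have [measurable]: "(\<lambda>\<omega>. W (t \<omega>) \<omega>) \<in> borel_measurable M"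
    unfolding t_def using measurable_grid_stopped[OF h] .
  have t: "0 \<le> t \<omega>" "t \<omega> \<le> real n * h" for \<omega>
    using h passage_index_le unfolding t_def grid_passage_def by (auto intro!: mult_right_mono)
  have le: "exp (b * W (t \<omega>) \<omega> - \<beta> * t \<omega>) \<le> ?C * exp (b * W (t \<omega>) \<omega> - b\<^sup>2 / 2 * t \<omega>)" for \<omega>
  proof -
    have "(b\<^sup>2 / 2 - \<beta>) * t \<omega> \<le> \<bar>b\<^sup>2 / 2 - \<beta>\<bar> * (real n * h)"
      using t by (intro mult_mono) auto
    then show ?thesis unfolding exp_add[symmetric] by (simp add: algebra_simps)
  qed
  have M: "integrable M (\<lambda>\<omega>. exp (b * W (t \<omega>) \<omega> - b\<^sup>2 / 2 * t \<omega>))"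
    "expectation (\<lambda>\<omega>. exp (b * W (t \<omega>) \<omega> - b\<^sup>2 / 2 * t \<omega>)) = 1"
    unfolding t_def by (rule stopped_exponential[OF h b])+
  show int: "integrable M (\<lambda>\<omega>. exp (b * W (t \<omega>) \<omega> - \<beta> * t \<omega>))"
    by (rule Bochner_Integration.integrable_bound[OF integrable_mult_right[OF M(1), of ?C]])
       (use le in auto)
  have "expectation (\<lambda>\<omega>. exp (b * W (t \<omega>) \<omega> - \<beta> * t \<omega>))
      \<le> expectation (\<lambda>\<omega>. ?C * exp (b * W (t \<omega>) \<omega> - b\<^sup>2 / 2 * t \<omega>))"
    using int M(1) le by (intro integral_mono) auto
  then show "expectation (\<lambda>\<omega>. exp (b * W (t \<omega>) \<omega> - \<beta> * t \<omega>)) \<le> ?C"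
    using M by simp
qed

text \<open>
  Write \<open>m\<^sub>i = exp (c X\<^sub>i - c\<^sup>2 i h / 2)\<close> and \<open>d\<^sub>i = m\<^sub>i exp (a X\<^sub>i)\<close>. In one step the conditional mean of
  \<open>m\<^sub>i S\<^sub>i\<close> grows by \<open>h d\<^sub>i\<close>, and that of \<open>d\<^sub>i\<close> by \<open>d\<^sub>i (exp (\<kappa> h) - 1)\<close>. So \<open>m\<^sub>i S\<^sub>i - q d\<^sub>i\<close> is a
  martingale for \<open>q = h / (exp (\<kappa> h) - 1)\<close>; its initial value is \<open>- q\<close>.
\<close>

lemma stopped_area:
  fixes l :: real and n :: nat
  assumes h: "0 < h" and c: "0 \<le> c" "0 \<le> c + a" and \<kappa>: "\<kappa> = a\<^sup>2 / 2 + c * a" "\<kappa> \<noteq> 0"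
  defines "t \<equiv> \<lambda>\<omega>. real (grid_passage h l n \<omega>) * h"
    and "S \<equiv> \<lambda>\<omega>. \<Sum>j<grid_passage h l n \<omega>. h * exp (a * W (real j * h) \<omega>)"
  shows "integrable M (\<lambda>\<omega>. exp (c * W (t \<omega>) \<omega> - c\<^sup>2 / 2 * t \<omega>) * S \<omega>)"
    "expectation (\<lambda>\<omega>. exp (c * W (t \<omega>) \<omega> - c\<^sup>2 / 2 * t \<omega>) * S \<omega>)
      = h / (exp (\<kappa> * h) - 1) * (expectation (\<lambda>\<omega>. exp ((c + a) * W (t \<omega>) \<omega> - c\<^sup>2 / 2 * t \<omega>)) - 1)"
proof -
  define b where "b = c + a"
  have b: "0 \<le> b" using c by (simp add: b_def)
  have b2: "b\<^sup>2 / 2 - c\<^sup>2 / 2 = \<kappa>" by (simp add: b_def \<kappa> power2_eq_square field_simps)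
  define q where "q = h / (exp (\<kappa> * h) - 1)"
  have q: "q * (exp (\<kappa> * h) - 1) = h"
    using \<kappa>(2) h by (simp add: q_def)
  define m where "m i \<omega> = exp (c * W (real i * h) \<omega> - c\<^sup>2 / 2 * (real i * h))" for i :: nat and \<omega>
  define d where "d i \<omega> = exp (b * W (real i * h) \<omega> - c\<^sup>2 / 2 * (real i * h))" for i :: nat and \<omega>
  define s where "s i \<omega> = (\<Sum>j<i. h * exp (a * W (real j * h) \<omega>))" for i :: nat and \<omega>
  define Y where "Y i \<omega> = m i \<omega> * s i \<omega> - q * d i \<omega>" for i \<omega>
  define F where "F i v = (\<Sum>j<Suc i. h * exp (a * v j))" for i :: nat and v :: "nat \<Rightarrow> real"
  define u1 where "u1 i v = (if \<forall>j\<in>{..i}. v j < l then exp (c * v i - c\<^sup>2 / 2 * (real i * h)) * F i v else 0)"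
    for i :: nat and v :: "nat \<Rightarrow> real"
  define u2 where "u2 i v = (if \<forall>j\<in>{..i}. v j < l then exp (b * v i - c\<^sup>2 / 2 * (real i * h)) * 1 else 0)"
    for i :: nat and v :: "nat \<Rightarrow> real"
  define g1 where "g1 x = exp (c * x) * exp (- (c\<^sup>2 / 2 * h)) - 1" for x :: real
  define g2 where "g2 x = h - q * (exp (b * x) * exp (- (c\<^sup>2 / 2 * h)) - 1)" for x :: real
  define x where "x i \<omega> = W (real (Suc i) * h) \<omega> - W (real i * h) \<omega>" for i :: nat and \<omega>
  define P where "P i \<omega> = (\<lambda>j\<in>{..i}. W (real j * h) \<omega>)" for i :: nat and \<omega>
  \<comment> \<open>one factor of each product depends on the past, the other one on the next increment\<close>
  have eq: "(if \<forall>j\<in>{..i}. W (real j * h) \<omega> < l then Y (Suc i) \<omega> - Y i \<omega> else 0)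
    = u1 i (P i \<omega>) * g1 (x i \<omega>) + u2 i (P i \<omega>) * g2 (x i \<omega>)" for i \<omega>
  proof -
    have ms: "m (Suc i) \<omega> = m i \<omega> * (exp (c * x i \<omega>) * exp (- (c\<^sup>2 / 2 * h)))"
      and ds: "d (Suc i) \<omega> = d i \<omega> * (exp (b * x i \<omega>) * exp (- (c\<^sup>2 / 2 * h)))"
      unfolding m_def d_def x_def exp_add[symmetric] by (simp_all add: algebra_simps)
    have ss: "s (Suc i) \<omega> = s i \<omega> + h * exp (a * W (real i * h) \<omega>)"
      by (simp add: s_def)
    have md: "m i \<omega> * exp (a * W (real i * h) \<omega>) = d i \<omega>"
      unfolding m_def d_def b_def exp_add[symmetric] by (simp add: algebra_simps)
    have "Y (Suc i) \<omega> - Y i \<omega> = m i \<omega> * s (Suc i) \<omega> * g1 (x i \<omega>)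
        + m i \<omega> * (s (Suc i) \<omega> - s i \<omega>) - q * d i \<omega> * (exp (b * x i \<omega>) * exp (- (c\<^sup>2 / 2 * h)) - 1)"
      unfolding Y_def ms ds g1_def by (simp add: algebra_simps)
    also have "m i \<omega> * (s (Suc i) \<omega> - s i \<omega>) = h * d i \<omega>"
      unfolding ss md[symmetric] by simp
    finally have "Y (Suc i) \<omega> - Y i \<omega> = m i \<omega> * s (Suc i) \<omega> * g1 (x i \<omega>) + d i \<omega> * g2 (x i \<omega>)"
      by (simp add: g2_def algebra_simps)
    moreover have "F i (P i \<omega>) = s (Suc i) \<omega>"
      unfolding F_def P_def s_def by (intro sum.cong) auto
    ultimately show ?thesis
      by (simp add: u1_def u2_def m_def d_def P_def)
  qed
  have F: "F i \<in> borel_measurable (PiM {..i} (\<lambda>_. borel))" for i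
    unfolding F_def
    by (intro borel_measurable_sum borel_measurable_times borel_measurable_const borel_measurable_exp measurable_component_singleton
        measurable_compose[OF _ borel_measurable_exp] ) auto
  have Fint: "integrable M (\<lambda>\<omega>. F i (P i \<omega>))" for i
    unfolding F_def P_def using h
    by (intro Bochner_Integration.integrable_sum integrable_mult_right) (auto intro!: exponential_moment_integrable)
  have u1: "u1 i \<in> borel_measurable (PiM {..i} (\<lambda>_. borel))" "integrable M (\<lambda>\<omega>. u1 i (P i \<omega>))" for i
    unfolding u1_def P_def by (rule integrable_exponential_below_level[OF h c(1) F Fint[unfolded P_def]])+
  have u2: "u2 i \<in> borel_measurable (PiM {..i} (\<lambda>_. borel))" "integrable M (\<lambda>\<omega>. u2 i (P i \<omega>))" for i
    unfolding u2_def P_def by (rule integrable_exponential_below_level[OF h b]; simp)+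
  have incr: "integrable M (\<lambda>\<omega>. exp (k * x i \<omega>))"
    "expectation (\<lambda>\<omega>. exp (k * x i \<omega>)) = exp (k\<^sup>2 * h / 2)" for i k
    using increment_exponential_moment[of "real i * h" "real (Suc i) * h" k] h by (auto simp: algebra_simps x_def)
  have G1: "integrable M (\<lambda>\<omega>. g1 (x i \<omega>))" "expectation (\<lambda>\<omega>. g1 (x i \<omega>)) = 0" for i
    unfolding g1_def using incr[of c i] by (simp_all add: prob_space exp_minus field_simps)
  have G2: "integrable M (\<lambda>\<omega>. g2 (x i \<omega>))" "expectation (\<lambda>\<omega>. g2 (x i \<omega>)) = 0" for i
  proof -
    show "integrable M (\<lambda>\<omega>. g2 (x i \<omega>))"
      unfolding g2_def using incr[of b i] by simp
    have "exp (b\<^sup>2 * h / 2) * exp (- (c\<^sup>2 / 2 * h)) = exp ((b\<^sup>2 / 2 - c\<^sup>2 / 2) * h)"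
      unfolding exp_add[symmetric] by (simp add: algebra_simps)
    then show "expectation (\<lambda>\<omega>. g2 (x i \<omega>)) = 0"
      unfolding g2_def using incr[of b i] q by (simp add: prob_space b2)
  qed
  have g: "g1 \<in> borel_measurable borel" "g2 \<in> borel_measurable borel"
    unfolding g1_def g2_def by measurable
  note step1 = past_indep_increment[OF h u1(1) g(1), folded x_def P_def, OF u1(2) G1(1)]
  note step2 = past_indep_increment[OF h u2(1) g(2), folded x_def P_def, OF u2(2) G2(1)]
  have Y0: "integrable M (Y 0)" "expectation (Y 0) = - q"
    using W_0 by (simp_all add: Y_def d_def s_def prob_space cong: Bochner_Integration.integrable_cong Bochner_Integration.integral_cong)
  have YY: "integrable M (\<lambda>\<omega>. Y (passage_index (\<lambda>i. W (real i * h) \<omega>) l n) \<omega>)"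
    "expectation (\<lambda>\<omega>. Y (passage_index (\<lambda>i. W (real i * h) \<omega>) l n) \<omega>) = expectation (Y 0)"
    by (rule optional_stopping[where X = "\<lambda>i. W (real i * h)" and Y = Y];
        simp add: eq step1 step2 G1 G2 Y0)+
  let ?D = "\<lambda>\<omega>. exp (b * W (t \<omega>) \<omega> - c\<^sup>2 / 2 * t \<omega>)"
  have D: "integrable M ?D"
    unfolding t_def by (rule stopped_exponential_bound[OF h b])
  have ZY: "exp (c * W (t \<omega>) \<omega> - c\<^sup>2 / 2 * t \<omega>) * S \<omega>
    = Y (passage_index (\<lambda>i. W (real i * h) \<omega>) l n) \<omega> + q * ?D \<omega>" for \<omega>
    by (simp add: Y_def m_def s_def d_def t_def S_def grid_passage_def)
  show "integrable M (\<lambda>\<omega>. exp (c * W (t \<omega>) \<omega> - c\<^sup>2 / 2 * t \<omega>) * S \<omega>)"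
    unfolding ZY using YY(1) D by simp
  show "expectation (\<lambda>\<omega>. exp (c * W (t \<omega>) \<omega> - c\<^sup>2 / 2 * t \<omega>) * S \<omega>)
      = h / (exp (\<kappa> * h) - 1) * (expectation (\<lambda>\<omega>. exp ((c + a) * W (t \<omega>) \<omega> - c\<^sup>2 / 2 * t \<omega>)) - 1)"
    unfolding ZY using YY Y0(2) D by (simp add: q_def[symmetric] b_def[symmetric] right_diff_distrib)
qed

end

section \<open>Refining the grid\<close>

lemma grid_factor_tendsto:
  fixes \<kappa> :: real
  assumes \<kappa>: "\<kappa> \<noteq> 0" and h: "\<And>m. 0 < h m" "h \<longlonglongrightarrow> 0"
  shows "(\<lambda>m. h m / (exp (\<kappa> * h m) - 1)) \<longlonglongrightarrow> 1 / \<kappa>"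
proof -
  have "(\<lambda>m. \<kappa> * h m) \<longlonglongrightarrow> \<kappa> * 0" by (intro tendsto_intros h)
  moreover have "h m \<noteq> 0" for m using h(1)[of m] by simp
  ultimately have "filterlim (\<lambda>m. \<kappa> * h m) (at 0) sequentially"
    using \<kappa> by (intro filterlim_atI always_eventually) auto
  with lim_exp_minus_1 have "((\<lambda>z. (exp z - 1) / z) \<circ> (\<lambda>m. \<kappa> * h m)) \<longlonglongrightarrow> 1"
    unfolding o_def by (rule filterlim_compose)
  then have "(\<lambda>m. 1 / \<kappa> * inverse ((exp (\<kappa> * h m) - 1) / (\<kappa> * h m))) \<longlonglongrightarrow> 1 / \<kappa> * inverse 1"
    unfolding o_def by (intro tendsto_intros) auto
  moreover have "1 / \<kappa> * inverse ((exp (\<kappa> * h m) - 1) / (\<kappa> * h m)) = h m / (exp (\<kappa> * h m) - 1)" for m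
    using \<kappa> by simp
  ultimately show ?thesis using \<kappa> by simp
qed

context brownian_motion_from_0

begin

definition passage :: "real \<Rightarrow> real \<Rightarrow> 'a \<Rightarrow> real" where
  "passage l K \<omega> = passage_time (\<lambda>t. W t \<omega>) l K"

lemma dyadic_passage_eq_grid:
  "dyadic_passage (\<lambda>t. W t \<omega>) l K m = real (grid_passage (K / 2 ^ m) l (2 ^ m) \<omega>) * (K / 2 ^ m)"
  by (simp add: dyadic_passage_def grid_passage_def)

lemma grid_tendsto_passage:
  assumes "0 < K"
  shows "(\<lambda>m. real (grid_passage (K / 2 ^ m) l (2 ^ m) \<omega>) * (K / 2 ^ m)) \<longlonglongrightarrow> passage l K \<omega>"
  using dyadic_passage_tendsto[OF assms, of "\<lambda>t. W t \<omega>" l]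
  by (simp add: dyadic_passage_eq_grid[abs_def] passage_def)

lemma grid_passage_bounds:
  assumes "0 < K"
  shows "0 \<le> real (grid_passage (K / 2 ^ m) l (2 ^ m) \<omega>) * (K / 2 ^ m)"
    "real (grid_passage (K / 2 ^ m) l (2 ^ m) \<omega>) * (K / 2 ^ m) \<le> K"
  using dyadic_passage_bounds[OF assms, of "\<lambda>t. W t \<omega>" l m] by (simp_all add: dyadic_passage_eq_grid)

lemma passage_bounds: assumes "0 < K" shows "0 \<le> passage l K \<omega>" "passage l K \<omega> \<le> K"
  using passage_time_bounds[OF assms] by (auto simp: passage_def)

lemma W_grid_tendsto:
  assumes K: "0 < K" and \<omega>: "\<omega> \<in> space M"
  shows "(\<lambda>m. W (real (grid_passage (K / 2 ^ m) l (2 ^ m) \<omega>) * (K / 2 ^ m)) \<omega>) \<longlonglongrightarrow> W (passage l K \<omega>) \<omega>"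
  by (rule continuous_on_tendsto_compose[OF continuous_paths[OF \<omega>] grid_tendsto_passage[OF K]])
     (use passage_bounds[OF K] grid_passage_bounds[OF K] in auto)

lemma passage_exponential:
  fixes l K b \<beta> :: real
  assumes K: "0 < K" and b: "0 \<le> b"
  defines "t \<equiv> \<lambda>m \<omega>. real (grid_passage (K / 2 ^ m) l (2 ^ m) \<omega>) * (K / 2 ^ m)"
  shows "integrable M (\<lambda>\<omega>. exp (b * W (passage l K \<omega>) \<omega> - \<beta> * passage l K \<omega>))"
    "(\<lambda>m. expectation (\<lambda>\<omega>. exp (b * W (t m \<omega>) \<omega> - \<beta> * t m \<omega>)))
      \<longlonglongrightarrow> expectation (\<lambda>\<omega>. exp (b * W (passage l K \<omega>) \<omega> - \<beta> * passage l K \<omega>))"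
proof -
  let ?f = "\<lambda>m \<omega>. exp (b * W (t m \<omega>) \<omega> - \<beta> * t m \<omega>)"
  let ?C = "exp (\<bar>(2 * b)\<^sup>2 / 2 - 2 * \<beta>\<bar> * K)"
  have sq: "(?f m \<omega>)\<^sup>2 = exp (2 * b * W (t m \<omega>) \<omega> - 2 * \<beta> * t m \<omega>)" for m \<omega>
    unfolding power2_eq_square exp_add[symmetric] by (simp add: algebra_simps)
  have int: "integrable M (\<lambda>\<omega>. (?f m \<omega>)\<^sup>2)" "expectation (\<lambda>\<omega>. (?f m \<omega>)\<^sup>2) \<le> ?C" for m
    unfolding sq unfolding t_def
    using stopped_exponential_bound[OF dyadic_mesh(1)[OF K], of "2 * b" m l "2 ^ m" "2 * \<beta>"] b by simp_all
  have meas: "?f m \<in> borel_measurable M" for m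
    unfolding t_def
    using stopped_exponential_bound(1)[OF dyadic_mesh(1)[OF K] b, of m l "2 ^ m" \<beta>] by (rule borel_measurable_integrable)
  have lim: "(\<lambda>m. ?f m \<omega>) \<longlonglongrightarrow> exp (b * W (passage l K \<omega>) \<omega> - \<beta> * passage l K \<omega>)" if "\<omega> \<in> space M" for \<omega>
    unfolding t_def by (intro tendsto_intros W_grid_tendsto grid_tendsto_passage K that)
  show "integrable M (\<lambda>\<omega>. exp (b * W (passage l K \<omega>) \<omega> - \<beta> * passage l K \<omega>))"
    "(\<lambda>m. expectation (?f m)) \<longlonglongrightarrow> expectation (\<lambda>\<omega>. exp (b * W (passage l K \<omega>) \<omega> - \<beta> * passage l K \<omega>))"
    by (rule expectation_tendsto_L2_bounded[of ?f, OF lim _ meas int]; simp)+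
qed

lemma passage_exponential_martingale:
  assumes K: "0 < K" and c: "0 \<le> c"
  shows "expectation (\<lambda>\<omega>. exp (c * W (passage l K \<omega>) \<omega> - c\<^sup>2 / 2 * passage l K \<omega>)) = 1"
  using passage_exponential(2)[OF K c, of l "c\<^sup>2 / 2"] stopped_exponential(2)[OF dyadic_mesh(1)[OF K] c]
  by (intro LIMSEQ_unique[OF _ tendsto_const[of 1]]) simp

text \<open>
  The limit of \<open>stopped_area\<close> as the mesh tends to \<open>0\<close>. For \<open>a \<ge> 0\<close> the Riemann sums up to the
  passage time are bounded by \<open>K exp (a l)\<close>, and expectations converge; for negative \<open>a\<close>
  there is no such bound, and Fatou's lemma gives an inequality.
\<close>

lemma passage_area:
  fixes l K a c :: real
  assumes K: "0 < K" and c: "0 \<le> c" "0 \<le> c + a" and \<kappa>: "\<kappa> = a\<^sup>2 / 2 + c * a" "\<kappa> \<noteq> 0"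
  defines "\<tau> \<equiv> passage l K"
  defines "Z \<equiv> \<lambda>\<omega>. exp (c * W (\<tau> \<omega>) \<omega> - c\<^sup>2 / 2 * \<tau> \<omega>) * integral {0..\<tau> \<omega>} (\<lambda>s. exp (a * W s \<omega>))"
    and "R \<equiv> 1 / \<kappa> * (expectation (\<lambda>\<omega>. exp ((c + a) * W (\<tau> \<omega>) \<omega> - c\<^sup>2 / 2 * \<tau> \<omega>)) - 1)"
  shows "Z \<in> borel_measurable M" "(\<integral>\<^sup>+\<omega>. ennreal (Z \<omega>) \<partial>M) \<le> ennreal R"
    "0 \<le> a \<Longrightarrow> expectation Z = R"
proof -
  define h where "h m = K / 2 ^ m" for m
  define p where "p m \<omega> = grid_passage (h m) l (2 ^ m) \<omega>" for m \<omega>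
  define t where "t m \<omega> = real (p m \<omega>) * h m" for m \<omega>
  define S where "S m \<omega> = (\<Sum>j<p m \<omega>. h m * exp (a * W (real j * h m) \<omega>))" for m \<omega>
  define f where "f m \<omega> = exp (c * W (t m \<omega>) \<omega> - c\<^sup>2 / 2 * t m \<omega>) * S m \<omega>" for m \<omega>
  have h: "0 < h m" "h \<longlonglongrightarrow> 0" for m
    using dyadic_mesh[OF K] by (simp_all add: h_def[abs_def])
  have t: "0 \<le> t m \<omega>" "t m \<omega> \<le> K" "(\<lambda>m. t m \<omega>) \<longlonglongrightarrow> \<tau> \<omega>" for m \<omega>
    unfolding t_def p_def h_def \<tau>_def by (intro grid_passage_bounds grid_tendsto_passage K)+
  have lim: "(\<lambda>m. f m \<omega>) \<longlonglongrightarrow> Z \<omega>" if \<omega>: "\<omega> \<in> space M" for \<omega>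
  proof -
    have "(\<lambda>m. W (t m \<omega>) \<omega>) \<longlonglongrightarrow> W (\<tau> \<omega>) \<omega>"
      unfolding t_def p_def h_def \<tau>_def by (rule W_grid_tendsto[OF K \<omega>])
    moreover have "(\<lambda>m. S m \<omega>) \<longlonglongrightarrow> integral {0..\<tau> \<omega>} (\<lambda>s. exp (a * W s \<omega>))"
      unfolding S_def
    proof (rule riemann_sum_tendsto[where K = K])
      have "continuous_on {0..K} (\<lambda>s. W s \<omega>)"
        by (rule continuous_on_subset[OF continuous_paths[OF \<omega>]]) auto
      then show "continuous_on {0..K} (\<lambda>s. exp (a * W s \<omega>))"
        by (intro continuous_intros)
    qed (use h t in \<open>auto simp: t_def\<close>)
    ultimately show ?thesis
      unfolding f_def Z_def using t(3) by (intro tendsto_intros)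
  qed
  have f: "integrable M (f m)"
    "expectation (f m) = h m / (exp (\<kappa> * h m) - 1) * (expectation (\<lambda>\<omega>. exp ((c + a) * W (t m \<omega>) \<omega> - c\<^sup>2 / 2 * t m \<omega>)) - 1)" for m
    unfolding f_def t_def p_def S_def by (rule stopped_area[OF h(1) c \<kappa>])+
  have f_nonneg: "0 \<le> f m \<omega>" for m \<omega>
    unfolding f_def S_def using h by (intro mult_nonneg_nonneg sum_nonneg) (auto intro: less_imp_le)
  have Ef: "(\<lambda>m. expectation (f m)) \<longlonglongrightarrow> R"
    unfolding f(2) R_def
    by (intro tendsto_mult grid_factor_tendsto[OF \<kappa>(2)] h tendsto_diff tendsto_const)
       (unfold t_def p_def h_def \<tau>_def, rule passage_exponential[OF K c(2)])
  show "Z \<in> borel_measurable M"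
    by (rule borel_measurable_LIMSEQ_real[OF lim]) (use f in auto)
  show "(\<integral>\<^sup>+\<omega>. ennreal (Z \<omega>) \<partial>M) \<le> ennreal R"
    by (rule nn_integral_le_of_tendsto[where f = f, OF lim f_nonneg f(1) order_refl Ef])
  show "expectation Z = R" if a: "0 \<le> a"
  proof (rule LIMSEQ_unique[OF _ Ef])
    let ?e = "\<lambda>m \<omega>. exp (2 * c * W (t m \<omega>) \<omega> - c\<^sup>2 * t m \<omega>)"
    let ?B = "(K * exp (a * l))\<^sup>2"
    have e: "integrable M (?e m)" "expectation (?e m) \<le> exp (\<bar>(2 * c)\<^sup>2 / 2 - c\<^sup>2\<bar> * K)" for m
      unfolding t_def p_def
      using stopped_exponential_bound[OF h(1)[of m], of "2 * c" l "2 ^ m" "c\<^sup>2"] c by (simp_all add: h_def)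
    have sq: "(f m \<omega>)\<^sup>2 \<le> ?B * ?e m \<omega>" for m \<omega>
    proof -
      have "W (real j * h m) \<omega> \<le> l" if "j < p m \<omega>" for j
        using below_before_passage_index[of j "\<lambda>i. W (real i * h m) \<omega>"] that
        by (auto simp: p_def grid_passage_def intro: less_imp_le)
      then have "S m \<omega> \<le> (\<Sum>j<p m \<omega>. h m * exp (a * l))"
        unfolding S_def using a h(1)[of m] by (intro sum_mono mult_left_mono) (auto intro: mult_left_mono)
      also have "\<dots> = t m \<omega> * exp (a * l)" by (simp add: t_def)
      also have "\<dots> \<le> K * exp (a * l)" using t by (intro mult_right_mono) auto
      finally have "S m \<omega> \<le> K * exp (a * l)" .
      moreover have "0 \<le> S m \<omega>" unfolding S_def using h by (intro sum_nonneg mult_nonneg_nonneg) (auto intro: less_imp_le)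
      ultimately have "(S m \<omega>)\<^sup>2 \<le> ?B" by (rule power_mono)
      moreover have "(exp (c * W (t m \<omega>) \<omega> - c\<^sup>2 / 2 * t m \<omega>))\<^sup>2 = ?e m \<omega>"
        unfolding power2_eq_square exp_add[symmetric] by (simp add: algebra_simps)
      ultimately show ?thesis
        unfolding f_def power_mult_distrib by (simp add: mult.commute[of "?e m \<omega>"] mult_right_mono)
    qed
    have [measurable]: "f m \<in> borel_measurable M" for m using f(1) by blast
    have sq_int: "integrable M (\<lambda>\<omega>. (f m \<omega>)\<^sup>2)" for m
      by (rule Bochner_Integration.integrable_bound[OF integrable_mult_right[OF e(1), of ?B]])
         (use sq in \<open>auto simp: abs_mult\<close>)
    have "expectation (\<lambda>\<omega>. (f m \<omega>)\<^sup>2) \<le> ?B * exp (\<bar>(2 * c)\<^sup>2 / 2 - c\<^sup>2\<bar> * K)" for m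
    proof -
      have "expectation (\<lambda>\<omega>. (f m \<omega>)\<^sup>2) \<le> expectation (\<lambda>\<omega>. ?B * ?e m \<omega>)"
        using sq_int e(1) sq by (intro integral_mono) auto
      also have "\<dots> = ?B * expectation (?e m)" by simp
      also have "\<dots> \<le> ?B * exp (\<bar>(2 * c)\<^sup>2 / 2 - c\<^sup>2\<bar> * K)"
        using e(2) by (intro mult_left_mono) auto
      finally show ?thesis .
    qed
    then show "(\<lambda>m. expectation (f m)) \<longlonglongrightarrow> expectation Z"
      by (intro expectation_tendsto_L2_bounded[of f, OF lim f_nonneg _ sq_int]) auto
  qed
qed

end

section \<open>Optional stopping at the hitting time of 1\<close>

context brownian_motion_from_0

begin

text \<open>
  On paths that never reach \<open>1\<close> this is \<open>0\<close>, and so every integral over \<open>{0..T \<omega>}\<close> vanishes.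
\<close>

definition T :: "'a \<Rightarrow> real" where "T \<omega> = enn2real (hitting_time W 1 \<omega>)"

definition T_approx :: "nat \<Rightarrow> 'a \<Rightarrow> real" where
  "T_approx n = passage (level_seq n) (real n + 1)"

lemma measurable_hitting[measurable]: "hitting_time W 1 \<in> borel_measurable M"
  by (rule measurable_hitting_time[OF random_variable_at continuous_paths])

lemma measurable_T[measurable]: "T \<in> borel_measurable M"
  unfolding T_def by measurable

lemma T_nonneg: "0 \<le> T \<omega>"
  by (simp add: T_def)

lemma T_approx_nonneg: "0 \<le> T_approx n \<omega>"
  unfolding T_approx_def by (rule passage_bounds) simp

lemma W_le_1_before_T_approx:
  assumes "\<omega> \<in> space M" "0 \<le> s" "s \<le> T_approx n \<omega>"
  shows "W s \<omega> \<le> 1"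
proof -
  have "W s \<omega> \<le> level_seq n"
    using le_level_before_passage_time[OF _ continuous_paths[OF assms(1)], of "real n + 1" "level_seq n" s]
      assms W_0[OF assms(1)] level_seq_bounds(1)[of n]
    by (simp add: T_approx_def passage_def)
  then show ?thesis using level_seq_bounds(2)[of n] by simp
qed

lemma T_approx_exceeds:
  assumes \<omega>: "\<omega> \<in> space M" and R: "0 \<le> R" "\<And>s. 0 \<le> s \<Longrightarrow> s \<le> R \<Longrightarrow> W s \<omega> \<noteq> 1"
  shows "eventually (\<lambda>n. R < T_approx n \<omega>) sequentially"
  using passage_times_exceed[OF continuous_paths[OF \<omega>] W_0[OF \<omega>] R]
  by (simp add: T_approx_def passage_def)

lemma T_approx_tendsto:
  assumes \<omega>: "\<omega> \<in> space M" and fin: "hitting_time W 1 \<omega> \<noteq> \<infinity>"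
  shows "(\<lambda>n. T_approx n \<omega>) \<longlonglongrightarrow> T \<omega>"
proof (rule order_tendstoI)
  note hit = hitting_time_finite[OF continuous_paths[OF \<omega>] fin, folded T_def]
  fix R assume R: "R < T \<omega>"
  show "eventually (\<lambda>n. R < T_approx n \<omega>) sequentially"
  proof (cases "R < 0")
    case True
    then show ?thesis
      by (intro always_eventually allI less_le_trans[OF _ T_approx_nonneg]) simp
  next
    case False
    then show ?thesis using R hit(2) by (intro T_approx_exceeds \<omega>) auto
  qed
next
  note hit = hitting_time_finite[OF continuous_paths[OF \<omega>] fin, folded T_def]
  fix R assume R: "T \<omega> < R"
  \<comment> \<open>the levels are below \<open>1\<close>, and therefore passed before \<open>1\<close> is hit\<close>
  have "T_approx n \<omega> \<le> T \<omega>" for n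
    using passage_times_below_hit[OF continuous_paths[OF \<omega>] W_0[OF \<omega>] T_nonneg hit(1)]
    by (simp add: T_approx_def passage_def)
  then show "eventually (\<lambda>n. T_approx n \<omega> < R) sequentially"
    using R by (intro always_eventually allI) (rule le_less_trans)
qed

lemma T_approx_at_top:
  assumes \<omega>: "\<omega> \<in> space M" and inf: "hitting_time W 1 \<omega> = \<infinity>"
  shows "filterlim (\<lambda>n. T_approx n \<omega>) at_top sequentially"
  unfolding filterlim_at_top
proof
  fix R :: real
  have "eventually (\<lambda>n. max 0 R < T_approx n \<omega>) sequentially"
    using hitting_time_infinite[OF inf] by (intro T_approx_exceeds \<omega>) auto
  then show "eventually (\<lambda>n. R \<le> T_approx n \<omega>) sequentially"
    by eventually_elim auto
qed

lemma W_T_approx_tendsto: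
  assumes \<omega>: "\<omega> \<in> space M" and fin: "hitting_time W 1 \<omega> \<noteq> \<infinity>"
  shows "(\<lambda>n. W (T_approx n \<omega>) \<omega>) \<longlonglongrightarrow> 1"
  using continuous_on_tendsto_compose[OF continuous_paths[OF \<omega>] T_approx_tendsto[OF \<omega> fin]]
    hitting_time_finite(1)[OF continuous_paths[OF \<omega>] fin] T_approx_nonneg T_nonneg[of \<omega>]
  by (simp add: T_def)

lemma exponential_at_T_approx_le:
  assumes \<omega>: "\<omega> \<in> space M" and b: "0 \<le> b"
  shows "exp (b * W (T_approx n \<omega>) \<omega> - \<beta> * T_approx n \<omega>) \<le> exp (b - \<beta> * T_approx n \<omega>)"
proof -
  have "W (T_approx n \<omega>) \<omega> \<le> 1"
    using T_approx_nonneg by (intro W_le_1_before_T_approx[OF \<omega>]) auto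
  from mult_left_mono[OF this b] show ?thesis by simp
qed

lemma exponential_at_T_approx_integrable:
  "0 \<le> b \<Longrightarrow> integrable M (\<lambda>\<omega>. exp (b * W (T_approx n \<omega>) \<omega> - \<beta> * T_approx n \<omega>))"
  unfolding T_approx_def by (rule passage_exponential) auto

text \<open>
  The paths are at most \<open>1\<close> up to the approximating times, which bounds the exponentials. On paths
  that never reach \<open>1\<close> the times tend to infinity, and the discount factor makes the limit \<open>0\<close>.
\<close>

lemma exponential_at_T_approx_tendsto:
  assumes b: "0 \<le> b" and \<beta>: "0 < \<beta>"
  shows "(\<lambda>n. expectation (\<lambda>\<omega>. exp (b * W (T_approx n \<omega>) \<omega> - \<beta> * T_approx n \<omega>)))
    \<longlonglongrightarrow> expectation (\<lambda>\<omega>. if hitting_time W 1 \<omega> = \<infinity> then 0 else exp (b - \<beta> * T \<omega>))"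
proof (rule integral_dominated_convergence[where w = "\<lambda>_. exp b"])
  show "(\<lambda>\<omega>. if hitting_time W 1 \<omega> = \<infinity> then 0 else exp (b - \<beta> * T \<omega>)) \<in> borel_measurable M"
    by measurable
  show "(\<lambda>\<omega>. exp (b * W (T_approx n \<omega>) \<omega> - \<beta> * T_approx n \<omega>)) \<in> borel_measurable M" for n
    using exponential_at_T_approx_integrable[OF b] by (rule borel_measurable_integrable)
  show "AE \<omega> in M. norm (exp (b * W (T_approx n \<omega>) \<omega> - \<beta> * T_approx n \<omega>)) \<le> exp b" for n
  proof (rule AE_I2)
    fix \<omega> assume \<omega>: "\<omega> \<in> space M"
    have "exp (b - \<beta> * T_approx n \<omega>) \<le> exp b" using \<beta> T_approx_nonneg by simp
    with exponential_at_T_approx_le[OF \<omega> b, of n \<beta>]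
    show "norm (exp (b * W (T_approx n \<omega>) \<omega> - \<beta> * T_approx n \<omega>)) \<le> exp b" by simp
  qed
  show "AE \<omega> in M. (\<lambda>n. exp (b * W (T_approx n \<omega>) \<omega> - \<beta> * T_approx n \<omega>))
      \<longlonglongrightarrow> (if hitting_time W 1 \<omega> = \<infinity> then 0 else exp (b - \<beta> * T \<omega>))"
  proof (rule AE_I2)
    fix \<omega> assume \<omega>: "\<omega> \<in> space M"
    show "(\<lambda>n. exp (b * W (T_approx n \<omega>) \<omega> - \<beta> * T_approx n \<omega>))
      \<longlonglongrightarrow> (if hitting_time W 1 \<omega> = \<infinity> then 0 else exp (b - \<beta> * T \<omega>))"
    proof (cases "hitting_time W 1 \<omega> = \<infinity>")
      case True
      have "((\<lambda>x. exp (b - \<beta> * x)) \<longlongrightarrow> 0) at_top"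
        using \<beta> by real_asymp
      from filterlim_compose[OF this T_approx_at_top[OF \<omega> True]]
      have "(\<lambda>n. exp (b - \<beta> * T_approx n \<omega>)) \<longlonglongrightarrow> 0" .
      then have "(\<lambda>n. exp (b * W (T_approx n \<omega>) \<omega> - \<beta> * T_approx n \<omega>)) \<longlonglongrightarrow> 0"
        by (rule tendsto_sandwich[OF _ _ tendsto_const, rotated 2])
           (use exponential_at_T_approx_le[OF \<omega> b, of _ \<beta>] in auto)
      then show ?thesis using True by simp
    next
      case False
      have "(\<lambda>n. exp (b * W (T_approx n \<omega>) \<omega> - \<beta> * T_approx n \<omega>)) \<longlonglongrightarrow> exp (b * 1 - \<beta> * T \<omega>)"
        by (intro tendsto_intros W_T_approx_tendsto T_approx_tendsto \<omega> False)
      then show ?thesis using False by simp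
    qed
  qed
qed simp

text \<open>
  The case \<open>b = c\<close> is the optional stopping theorem for the exponential martingale at \<open>T\<close>, and the
  constant factor \<open>exp b\<close> is arbitrary.
\<close>

lemma laplace_transform_T:
  assumes c: "0 < c"
  shows "expectation (\<lambda>\<omega>. if hitting_time W 1 \<omega> = \<infinity> then 0 else exp (b - c\<^sup>2 / 2 * T \<omega>)) = exp (b - c)"
proof -
  have 1: "expectation (\<lambda>\<omega>. if hitting_time W 1 \<omega> = \<infinity> then 0 else exp (c - c\<^sup>2 / 2 * T \<omega>)) = 1"
  proof -
    have one: "expectation (\<lambda>\<omega>. exp (c * W (T_approx n \<omega>) \<omega> - c\<^sup>2 / 2 * T_approx n \<omega>)) = 1" for n
      unfolding T_approx_def by (rule passage_exponential_martingale) (use c in auto)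
    have "(\<lambda>n. expectation (\<lambda>\<omega>. exp (c * W (T_approx n \<omega>) \<omega> - c\<^sup>2 / 2 * T_approx n \<omega>)))
      \<longlonglongrightarrow> expectation (\<lambda>\<omega>. if hitting_time W 1 \<omega> = \<infinity> then 0 else exp (c - c\<^sup>2 / 2 * T \<omega>))"
      using c by (intro exponential_at_T_approx_tendsto) auto
    from LIMSEQ_unique[OF this[unfolded one] tendsto_const] show ?thesis .
  qed
  have "(if hitting_time W 1 \<omega> = \<infinity> then 0 else exp (b - c\<^sup>2 / 2 * T \<omega>))
    = exp (b - c) * (if hitting_time W 1 \<omega> = \<infinity> then 0 else exp (c - c\<^sup>2 / 2 * T \<omega>))" for \<omega>
    by (simp flip: exp_add)
  then show ?thesis using 1 by simp
qed

definition discounted_area :: "real \<Rightarrow> real \<Rightarrow> 'a \<Rightarrow> real" where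
  "discounted_area c a \<omega> = exp (- (c\<^sup>2 / 2 * T \<omega>)) * integral {0..T \<omega>} (\<lambda>s. exp (a * W s \<omega>))"

lemma measurable_path_integral_T:
  assumes g: "continuous_on UNIV g"
  shows "(\<lambda>\<omega>. integral {0..T \<omega>} (\<lambda>s. g (W s \<omega>) :: real)) \<in> borel_measurable M"
proof -
  have cont: "continuous_on {0..} (\<lambda>s. g (W s \<omega>))" if "\<omega> \<in> space M" for \<omega>
    by (rule continuous_on_compose2[OF g continuous_paths[OF that]]) auto
  have "(\<lambda>\<omega>. LBINT s:{0..T \<omega>}. g (W s \<omega>)) \<in> borel_measurable M"
    using cont borel_measurable_continuous_onI[OF g]
    by (intro measurable_path_integral measurable_T) (auto intro: measurable_compose[OF random_variable_at])
  then show ?thesis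
    by (simp add: set_lebesgue_integral_eq_integral_continuous cont cong: measurable_cong)
qed

lemma measurable_discounted_area[measurable]: "discounted_area c a \<in> borel_measurable M"
proof -
  have [measurable]: "(\<lambda>\<omega>. integral {0..T \<omega>} (\<lambda>s. exp (a * W s \<omega>))) \<in> borel_measurable M"
    by (rule measurable_path_integral_T[of "\<lambda>x. exp (a * x)"]) (intro continuous_intros)
  show ?thesis unfolding discounted_area_def by measurable
qed

text \<open>
  The factor \<open>exp (- c)\<close> compensates for the value of \<open>exp (c * W)\<close> where \<open>W\<close> is \<open>1\<close>.
\<close>

definition approx_area :: "real \<Rightarrow> real \<Rightarrow> nat \<Rightarrow> 'a \<Rightarrow> real" where
  "approx_area c a n \<omega> = exp (- c) * (exp (c * W (T_approx n \<omega>) \<omega> - c\<^sup>2 / 2 * T_approx n \<omega>)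
    * integral {0..T_approx n \<omega>} (\<lambda>s. exp (a * W s \<omega>)))"

lemma approx_area_tendsto:
  fixes c a \<kappa> :: real
  assumes c: "0 < c" "0 \<le> c + a" and a: "a \<noteq> 0" and \<kappa>: "\<kappa> = a\<^sup>2 / 2 + c * a"
  shows "approx_area c a n \<in> borel_measurable M"
    "\<exists>R. R \<longlonglongrightarrow> exp (- c) * (exp a - 1) / \<kappa> \<and> (\<forall>n. (\<integral>\<^sup>+\<omega>. ennreal (approx_area c a n \<omega>) \<partial>M) \<le> ennreal (R n))
      \<and> (0 \<le> a \<longrightarrow> (\<forall>n. expectation (approx_area c a n) = R n))"
    "\<And>\<omega>. \<omega> \<in> space M \<Longrightarrow> hitting_time W 1 \<omega> \<noteq> \<infinity> \<Longrightarrow> (\<lambda>n. approx_area c a n \<omega>) \<longlonglongrightarrow> discounted_area c a \<omega>"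
proof -
  have "0 < a / 2 + c" using c by linarith
  moreover have "\<kappa> = a * (a / 2 + c)" by (simp add: \<kappa> power2_eq_square algebra_simps)
  ultimately have \<kappa>0: "\<kappa> \<noteq> 0" using a by simp
  define R where "R n = exp (- c) * (1 / \<kappa> * (expectation (\<lambda>\<omega>. exp ((c + a) * W (T_approx n \<omega>) \<omega> - c\<^sup>2 / 2 * T_approx n \<omega>)) - 1))" for n
  have area_m: "(\<lambda>\<omega>. exp (c * W (T_approx n \<omega>) \<omega> - c\<^sup>2 / 2 * T_approx n \<omega>)
    * integral {0..T_approx n \<omega>} (\<lambda>s. exp (a * W s \<omega>))) \<in> borel_measurable M" for n
    using passage_area(1)[of "real n + 1" c a \<kappa> "level_seq n"] c \<kappa> \<kappa>0 by (simp add: T_approx_def)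
  then show "approx_area c a n \<in> borel_measurable M" for n
    unfolding approx_area_def by measurable
  \<comment> \<open>the limit of the expectations is \<open>exp ((c + a) - c)\<close> by the Laplace transform of \<open>T\<close>\<close>
  have "R \<longlonglongrightarrow> exp (- c) * (1 / \<kappa> * (exp (c + a - c) - 1))"
    unfolding R_def
    using exponential_at_T_approx_tendsto[of "c + a" "c\<^sup>2 / 2"] c laplace_transform_T[OF c(1), of "c + a"]
    by (intro tendsto_intros) simp
  then have "R \<longlonglongrightarrow> exp (- c) * (exp a - 1) / \<kappa>" by simp
  moreover have "(\<integral>\<^sup>+\<omega>. ennreal (approx_area c a n \<omega>) \<partial>M) \<le> ennreal (R n)" for n
  proof -
    let ?A = "\<lambda>\<omega>. exp (c * W (T_approx n \<omega>) \<omega> - c\<^sup>2 / 2 * T_approx n \<omega>)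
      * integral {0..T_approx n \<omega>} (\<lambda>s. exp (a * W s \<omega>))"
    note [measurable] = area_m[of n]
    have "(\<integral>\<^sup>+\<omega>. ennreal (approx_area c a n \<omega>) \<partial>M) = (\<integral>\<^sup>+\<omega>. ennreal (exp (- c)) * ennreal (?A \<omega>) \<partial>M)"
      unfolding approx_area_def by (intro nn_integral_cong ennreal_mult') simp
    also have "\<dots> = ennreal (exp (- c)) * (\<integral>\<^sup>+\<omega>. ennreal (?A \<omega>) \<partial>M)"
      by (rule nn_integral_cmult) measurable
    also have "\<dots> \<le> ennreal (exp (- c)) * ennreal (1 / \<kappa> * (expectation (\<lambda>\<omega>. exp ((c + a) * W (T_approx n \<omega>) \<omega> - c\<^sup>2 / 2 * T_approx n \<omega>)) - 1))"
      unfolding T_approx_def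
      by (intro mult_left_mono passage_area(2)) (use c \<kappa> \<kappa>0 in auto)
    also have "\<dots> = ennreal (R n)"
      unfolding R_def by (intro ennreal_mult'[symmetric]) simp
    finally show ?thesis .
  qed
  moreover have "expectation (approx_area c a n) = R n" if "0 \<le> a" for n
    unfolding approx_area_def R_def
    using passage_area(3)[of "real n + 1" c a \<kappa> "level_seq n"] c \<kappa> \<kappa>0 that
    by (simp add: T_approx_def)
  ultimately show "\<exists>R. R \<longlonglongrightarrow> exp (- c) * (exp a - 1) / \<kappa> \<and> (\<forall>n. (\<integral>\<^sup>+\<omega>. ennreal (approx_area c a n \<omega>) \<partial>M) \<le> ennreal (R n))
      \<and> (0 \<le> a \<longrightarrow> (\<forall>n. expectation (approx_area c a n) = R n))"
    by blast
  fix \<omega> assume \<omega>: "\<omega> \<in> space M" and fin: "hitting_time W 1 \<omega> \<noteq> \<infinity>"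
  have "continuous_on {0..} (\<lambda>s. exp (a * W s \<omega>))"
    by (intro continuous_intros continuous_paths \<omega>)
  then have "(\<lambda>n. integral {0..T_approx n \<omega>} (\<lambda>s. exp (a * W s \<omega>))) \<longlonglongrightarrow> integral {0..T \<omega>} (\<lambda>s. exp (a * W s \<omega>))"
    by (rule indefinite_integral_tendsto[OF _ T_approx_nonneg T_approx_tendsto[OF \<omega> fin]])
  then have "(\<lambda>n. approx_area c a n \<omega>) \<longlonglongrightarrow> exp (- c) * (exp (c * 1 - c\<^sup>2 / 2 * T \<omega>) * integral {0..T \<omega>} (\<lambda>s. exp (a * W s \<omega>)))"
    unfolding approx_area_def by (intro tendsto_intros W_T_approx_tendsto T_approx_tendsto \<omega> fin)
  moreover have "exp (- c) * (exp (c * 1 - c\<^sup>2 / 2 * T \<omega>) * integral {0..T \<omega>} (\<lambda>s. exp (a * W s \<omega>))) = discounted_area c a \<omega>"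
    unfolding discounted_area_def mult.assoc[symmetric] exp_add[symmetric] by simp
  ultimately show "(\<lambda>n. approx_area c a n \<omega>) \<longlonglongrightarrow> discounted_area c a \<omega>" by simp
qed

lemma discounted_area_infinite: "hitting_time W 1 \<omega> = \<infinity> \<Longrightarrow> discounted_area c a \<omega> = 0"
  by (simp add: discounted_area_def T_def)

lemma discounted_area_le:
  assumes c: "0 < c" "0 \<le> c + a" and a: "a \<noteq> 0"
  shows "(\<integral>\<^sup>+\<omega>. ennreal (discounted_area c a \<omega>) \<partial>M) \<le> ennreal (exp (- c) * (exp a - 1) / (a\<^sup>2 / 2 + c * a))"
proof -
  note approx = approx_area_tendsto[OF c a refl]
  from approx(2) obtain R where R: "R \<longlonglongrightarrow> exp (- c) * (exp a - 1) / (a\<^sup>2 / 2 + c * a)"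
    "\<forall>n. (\<integral>\<^sup>+\<omega>. ennreal (approx_area c a n \<omega>) \<partial>M) \<le> ennreal (R n)"
    by (elim exE conjE) (rule that)
  show ?thesis
  proof (rule nn_integral_le_of_liminf[OF _ _ R(2)[rule_format] R(1)])
    fix \<omega> assume \<omega>: "\<omega> \<in> space M"
    show "ennreal (discounted_area c a \<omega>) \<le> liminf (\<lambda>n. ennreal (approx_area c a n \<omega>))"
    proof (cases "hitting_time W 1 \<omega> = \<infinity>")
      case True
      then show ?thesis by (simp add: discounted_area_infinite)
    next
      case False
      then have "liminf (\<lambda>n. ennreal (approx_area c a n \<omega>)) = ennreal (discounted_area c a \<omega>)"
        by (intro lim_imp_Liminf tendsto_ennrealI approx(3) \<omega>) auto
      then show ?thesis by simp
    qed
  qed (intro measurable_compose[OF approx(1)] measurable_ennreal)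
qed

text \<open>
  For \<open>a > 0\<close> the integral up to the time \<open>t\<close> is at most \<open>exp a * t\<close>, and the discount factor makes
  this bounded in \<open>t\<close> and negligible for large \<open>t\<close>; hence dominated convergence applies.
\<close>

lemma discounted_area_eq:
  assumes c: "0 < c" and a: "0 < a"
  shows "integrable M (discounted_area c a)"
    "expectation (discounted_area c a) = exp (- c) * (exp a - 1) / (a\<^sup>2 / 2 + c * a)"
proof -
  have ca: "0 \<le> c + a" "a \<noteq> 0" using c a by auto
  note approx = approx_area_tendsto[OF c ca refl]
  let ?Z = "approx_area c a"
  from approx(2) obtain R where R: "R \<longlonglongrightarrow> exp (- c) * (exp a - 1) / (a\<^sup>2 / 2 + c * a)"
    "0 \<le> a \<longrightarrow> (\<forall>n. expectation (?Z n) = R n)"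
    by (elim exE conjE) (rule that)
  define \<beta> where "\<beta> = c\<^sup>2 / 2"
  have \<beta>: "0 < \<beta>" using c by (simp add: \<beta>_def)
  have Z: "0 \<le> ?Z n \<omega>" "?Z n \<omega> \<le> exp a * (T_approx n \<omega> * exp (- \<beta> * T_approx n \<omega>))" if \<omega>: "\<omega> \<in> space M" for n \<omega>
  proof -
    have cont: "continuous_on {0..} (\<lambda>s. exp (a * W s \<omega>))"
      by (intro continuous_intros continuous_paths \<omega>)
    have int: "(\<lambda>s. exp (a * W s \<omega>)) integrable_on {0..T_approx n \<omega>}"
      by (intro integrable_continuous_real continuous_on_subset[OF cont]) auto
    show "0 \<le> ?Z n \<omega>"
      unfolding approx_area_def using int by (intro mult_nonneg_nonneg integral_nonneg) auto
    have "integral {0..T_approx n \<omega>} (\<lambda>s. exp (a * W s \<omega>)) \<le> integral {0..T_approx n \<omega>} (\<lambda>s. exp a)"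
      using a W_le_1_before_T_approx[OF \<omega>] by (intro integral_le int) (auto simp: mult_left_le)
    then have "integral {0..T_approx n \<omega>} (\<lambda>s. exp (a * W s \<omega>)) \<le> exp a * T_approx n \<omega>"
      using T_approx_nonneg by (simp add: mult.commute)
    moreover have "exp (- c) * exp (c * W (T_approx n \<omega>) \<omega> - c\<^sup>2 / 2 * T_approx n \<omega>) \<le> exp (- \<beta> * T_approx n \<omega>)"
    proof -
      have "exp (- c) * exp (c * W (T_approx n \<omega>) \<omega> - c\<^sup>2 / 2 * T_approx n \<omega>) \<le> exp (- c) * exp (c - c\<^sup>2 / 2 * T_approx n \<omega>)"
        using c by (intro mult_left_mono exponential_at_T_approx_le[OF \<omega>]) auto
      also have "\<dots> = exp (- \<beta> * T_approx n \<omega>)" unfolding exp_add[symmetric] by (simp add: \<beta>_def)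
      finally show ?thesis .
    qed
    ultimately have "(exp (- c) * exp (c * W (T_approx n \<omega>) \<omega> - c\<^sup>2 / 2 * T_approx n \<omega>))
      * integral {0..T_approx n \<omega>} (\<lambda>s. exp (a * W s \<omega>)) \<le> exp (- \<beta> * T_approx n \<omega>) * (exp a * T_approx n \<omega>)"
      using int by (intro mult_mono integral_nonneg) auto
    then show "?Z n \<omega> \<le> exp a * (T_approx n \<omega> * exp (- \<beta> * T_approx n \<omega>))"
      by (simp add: approx_area_def mult_ac)
  qed
  have bound: "x * exp (- \<beta> * x) \<le> 1 / \<beta>" for x :: real
  proof -
    have "\<beta> * x \<le> exp (\<beta> * x)" using exp_ge_add_one_self[of "\<beta> * x"] by linarith
    then show ?thesis using \<beta> by (simp add: exp_minus field_simps)
  qed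
  have lim: "(\<lambda>n. ?Z n \<omega>) \<longlonglongrightarrow> discounted_area c a \<omega>" if \<omega>: "\<omega> \<in> space M" for \<omega>
  proof (cases "hitting_time W 1 \<omega> = \<infinity>")
    case True
    have "((\<lambda>x. exp a * (x * exp (- \<beta> * x))) \<longlongrightarrow> 0) at_top"
      using \<beta> by real_asymp
    from filterlim_compose[OF this T_approx_at_top[OF \<omega> True]]
    have "(\<lambda>n. exp a * (T_approx n \<omega> * exp (- \<beta> * T_approx n \<omega>))) \<longlonglongrightarrow> 0" .
    then have "(\<lambda>n. ?Z n \<omega>) \<longlonglongrightarrow> 0"
      by (rule tendsto_sandwich[OF _ _ tendsto_const, rotated 2]) (use Z[OF \<omega>] in auto)
    then show ?thesis by (simp add: discounted_area_infinite[OF True])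
  next
    case False
    then show ?thesis by (rule approx(3)[OF \<omega>])
  qed
  have Z_le: "AE \<omega> in M. norm (?Z n \<omega>) \<le> exp a * (1 / \<beta>)" for n
  proof (rule AE_I2)
    fix \<omega> assume \<omega>: "\<omega> \<in> space M"
    have "exp a * (T_approx n \<omega> * exp (- \<beta> * T_approx n \<omega>)) \<le> exp a * (1 / \<beta>)"
      by (intro mult_left_mono bound) simp
    with Z[OF \<omega>, of n] show "norm (?Z n \<omega>) \<le> exp a * (1 / \<beta>)"
      unfolding real_norm_def abs_of_nonneg[OF Z(1)[OF \<omega>]] by linarith
  qed
  have Z_m: "?Z n \<in> borel_measurable M" for n
    by (rule approx(1))
  note dct = integral_dominated_convergence[where s = ?Z and f = "discounted_area c a" and w = "\<lambda>_. exp a * (1 / \<beta>)" and M = M]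
    integrable_dominated_convergence[where s = ?Z and f = "discounted_area c a" and w = "\<lambda>_. exp a * (1 / \<beta>)" and M = M]
  show "integrable M (discounted_area c a)"
    using Z_m Z_le lim by (intro dct(2)) (auto intro!: AE_I2)
  have "(\<lambda>n. expectation (?Z n)) \<longlonglongrightarrow> expectation (discounted_area c a)"
    using Z_m Z_le lim by (intro dct(1)) (auto intro!: AE_I2)
  then show "expectation (discounted_area c a) = exp (- c) * (exp a - 1) / (a\<^sup>2 / 2 + c * a)"
    using R a by (intro LIMSEQ_unique) auto
qed

end

section \<open>Exponential integrability\<close>

text \<open>
  Jensen's inequality for \<open>exp\<close> and the uniform distribution on \<open>{0..t}\<close>: integrate the tangent
  inequality \<open>exp m * (1 + (x - m)) \<le> exp x\<close> at the average \<open>m\<close>.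
\<close>

lemma exp_average_le:
  fixes f :: "real \<Rightarrow> real"
  assumes f: "continuous_on {0..t} f" and t: "0 \<le> t"
  shows "t * exp (integral {0..t} f / t) \<le> integral {0..t} (\<lambda>s. exp (f s))"
proof (cases "t = 0")
  case False
  define m where "m = integral {0..t} f / t"
  have int: "f integrable_on {0..t}" "(\<lambda>s. exp (f s)) integrable_on {0..t}"
    using f by (auto intro!: integrable_continuous_real continuous_intros)
  have eq: "integral {0..t} (\<lambda>s. exp m * ((1 - m) + f s)) = t * exp m"
  proof -
    have "integral {0..t} (\<lambda>s. exp m * ((1 - m) + f s)) = exp m * integral {0..t} (\<lambda>s. (1 - m) + f s)"
      by (rule Henstock_Kurzweil_Integration.integral_mult_right)
    also have "integral {0..t} (\<lambda>s. (1 - m) + f s) = t * (1 - m) + integral {0..t} f"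
      using int t by (subst Henstock_Kurzweil_Integration.integral_add) auto
    also have "integral {0..t} f = m * t" using False by (simp add: m_def)
    finally show ?thesis by (simp add: algebra_simps)
  qed
  have "integral {0..t} (\<lambda>s. exp m * ((1 - m) + f s)) \<le> integral {0..t} (\<lambda>s. exp (f s))"
  proof (rule integral_le)
    show "(\<lambda>s. exp m * ((1 - m) + f s)) integrable_on {0..t}"
      using f by (auto intro!: integrable_continuous_real continuous_intros)
    fix s
    have "exp m * (1 + (f s - m)) \<le> exp m * exp (f s - m)"
      by (intro mult_left_mono exp_ge_add_one_self) simp
    then show "exp m * ((1 - m) + f s) \<le> exp (f s)"
      by (simp flip: exp_add add: algebra_simps)
  qed (rule int)
  from this[unfolded eq] show ?thesis by (simp add: m_def)
qed simp

text \<open>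
  The weight \<open>c\<close> cancels the singularity of the quotient at \<open>c = 0\<close>, which is of order \<open>1 / c\<close>
  because \<open>exp a - 1\<close> is of order \<open>c\<close>; for large \<open>c\<close> there is exponential decay.
\<close>

lemma discounted_area_value_bound:
  fixes a c :: real
  assumes c: "0 < c" and a: "a = c / 2 \<or> a = - c / 2"
  shows "c * (exp (- c) * (exp a - 1) / (a\<^sup>2 / 2 + c * a)) \<le> 4 / 3 * exp (- c / 2)"
  using a
proof
  assume a: "a = c / 2"
  have "exp (c / 2) * (1 - c / 2) \<le> exp (c / 2) * exp (- (c / 2))"
    using exp_ge_add_one_self[of "- (c / 2)"] by (intro mult_left_mono) auto
  then have "exp (c / 2) - 1 \<le> c / 2 * exp (c / 2)"
    by (simp flip: exp_add add: algebra_simps)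
  then have "exp (- c) * (exp (c / 2) - 1) \<le> exp (- c) * (c / 2 * exp (c / 2))"
    by (intro mult_left_mono) auto
  also have "\<dots> = c / 2 * exp (- c / 2)"
    by (simp flip: exp_add add: mult.left_commute)
  finally have "8 / (5 * c) * (exp (- c) * (exp (c / 2) - 1)) \<le> 8 / (5 * c) * (c / 2 * exp (- c / 2))"
    using c by (intro mult_left_mono) auto
  also have "\<dots> \<le> 4 / 3 * exp (- c / 2)" using c by simp
  also have "8 / (5 * c) * (exp (- c) * (exp (c / 2) - 1)) = c * (exp (- c) * (exp a - 1) / (a\<^sup>2 / 2 + c * a))"
  proof -
    have "a\<^sup>2 / 2 + c * a = 5 * c\<^sup>2 / 8" by (simp add: a power2_eq_square)
    then show ?thesis using c by (simp add: a power2_eq_square field_simps)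
  qed
  finally show ?thesis .
next
  assume a: "a = - c / 2"
  have "exp (- c) * (1 - exp (- c / 2)) \<le> exp (- c / 2) * (c / 2)"
    using exp_ge_add_one_self[of "- c / 2"] c by (intro mult_mono) auto
  then have "8 / (3 * c) * (exp (- c) * (1 - exp (- c / 2))) \<le> 8 / (3 * c) * (exp (- c / 2) * (c / 2))"
    using c by (intro mult_left_mono) auto
  also have "\<dots> = 4 / 3 * exp (- c / 2)" using c by simp
  also have "8 / (3 * c) * (exp (- c) * (1 - exp (- c / 2))) = c * (exp (- c) * (exp a - 1) / (a\<^sup>2 / 2 + c * a))"
  proof -
    have "a\<^sup>2 / 2 + c * a = - (3 * c\<^sup>2 / 8)" by (simp add: a power2_eq_square)
    then show ?thesis using c by (simp add: a power2_eq_square field_simps)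
  qed
  finally show ?thesis .
qed

lemma powr_le_exp_half:
  fixes x r :: real
  assumes "0 < r" "0 \<le> x"
  shows "x powr r \<le> (2 * r) powr r * exp (x / 2)"
proof -
  have "x / (2 * r) \<le> exp (x / (2 * r))"
    using exp_ge_add_one_self[of "x / (2 * r)"] by linarith
  then have "x \<le> 2 * r * exp (x / (2 * r))" using assms by (simp add: field_simps)
  then have "x powr r \<le> (2 * r * exp (x / (2 * r))) powr r"
    using assms by (intro powr_mono2) auto
  also have "\<dots> = (2 * r) powr r * exp (x / 2)"
    using assms by (simp add: powr_mult exp_powr_real)
  finally show ?thesis .
qed

context brownian_motion_from_0

begin

definition area :: "'a \<Rightarrow> real" where "area \<omega> = integral {0..T \<omega>} (\<lambda>s. W s \<omega>)"

lemma measurable_signed_area[measurable]: "area \<in> borel_measurable M"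
  unfolding area_def by (rule measurable_path_integral_T[of "\<lambda>x. x"]) (intro continuous_intros)

lemma area_T_0: "T \<omega> = 0 \<Longrightarrow> area \<omega> = 0"
  by (simp add: area_def)

lemma normalized_area_eq:
  assumes "\<omega> \<in> space M"
  shows "normalized_area W \<omega> = area \<omega> / T \<omega> powr (3 / 2)"
  by (simp add: normalized_area_def area_def T_def[symmetric] Let_def
      set_lebesgue_integral_eq_integral_continuous[OF continuous_paths[OF assms]])

lemma measurable_normalized_area: "normalized_area W \<in> borel_measurable M"
  by (subst measurable_cong[OF normalized_area_eq]) measurable

lemma exp_area_le_discounted_area:
  assumes \<omega>: "\<omega> \<in> space M"
  shows "T \<omega> * exp (- (c\<^sup>2 / 2 * T \<omega>)) * exp (a * area \<omega> / T \<omega>) \<le> discounted_area c a \<omega>"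
proof -
  have "continuous_on {0..T \<omega>} (\<lambda>s. a * W s \<omega>)"
    by (intro continuous_intros continuous_on_subset[OF continuous_paths[OF \<omega>]]) auto
  from exp_average_le[OF this T_nonneg]
  have "T \<omega> * exp (a * area \<omega> / T \<omega>) \<le> integral {0..T \<omega>} (\<lambda>s. exp (a * W s \<omega>))"
    by (simp add: area_def)
  then have "exp (- (c\<^sup>2 / 2 * T \<omega>)) * (T \<omega> * exp (a * area \<omega> / T \<omega>)) \<le> discounted_area c a \<omega>"
    unfolding discounted_area_def by (intro mult_left_mono) auto
  then show ?thesis by (simp add: mult_ac)
qed

text \<open>
  If \<open>T \<omega> > 0\<close>, then in terms of \<open>v = c * sqrt (T \<omega>)\<close> and the normalized area \<open>A\<close>, this is
  \<open>sqrt (T \<omega>) * v * exp (- v\<^sup>2 / 2) * 2 * cosh (v * A / 2)\<close>. So its integral over \<open>c\<close> depends on \<open>A\<close>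
  alone.
\<close>

definition area_kernel :: "'a \<Rightarrow> real \<Rightarrow> real" where
  "area_kernel \<omega> c = c * (T \<omega> * exp (- (c\<^sup>2 / 2 * T \<omega>))
     * (exp (c / 2 * area \<omega> / T \<omega>) + exp (- c / 2 * area \<omega> / T \<omega>)))"

text \<open>
  The two exponentials are handled by \<open>a = c / 2\<close> and \<open>a = - c / 2\<close> in \<open>discounted_area_le\<close>.
\<close>

lemma area_kernel_mean_le:
  assumes c: "0 \<le> c"
  shows "(\<integral>\<^sup>+\<omega>. ennreal (area_kernel \<omega> c) \<partial>M) \<le> ennreal (8 / 3 * exp (- c / 2))"
proof (cases "c = 0")
  case True
  then show ?thesis by (simp add: area_kernel_def)
next
  case False
  then have c: "0 < c" using c by simp
  let ?v = "\<lambda>a. exp (- c) * (exp a - 1) / (a\<^sup>2 / 2 + c * a)"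
  have le: "(\<integral>\<^sup>+\<omega>. ennreal (c * discounted_area c a \<omega>) \<partial>M) \<le> ennreal (4 / 3 * exp (- c / 2))"
    if a: "a = c / 2 \<or> a = - c / 2" for a
  proof -
    have "(\<integral>\<^sup>+\<omega>. ennreal (c * discounted_area c a \<omega>) \<partial>M) = ennreal c * (\<integral>\<^sup>+\<omega>. ennreal (discounted_area c a \<omega>) \<partial>M)"
      using c by (simp add: ennreal_mult' nn_integral_cmult)
    also have "\<dots> \<le> ennreal c * ennreal (?v a)"
      using c a by (intro mult_left_mono discounted_area_le) auto
    also have "\<dots> = ennreal (c * ?v a)"
      using c by (intro ennreal_mult'[symmetric]) simp
    also have "\<dots> \<le> ennreal (4 / 3 * exp (- c / 2))"
      by (intro ennreal_leI discounted_area_value_bound c a)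
    finally show ?thesis .
  qed
  have nonneg: "0 \<le> discounted_area c a \<omega>" if "\<omega> \<in> space M" for a \<omega>
    by (rule order_trans[OF _ exp_area_le_discounted_area[OF that]]) (use T_nonneg in simp)
  have "(\<integral>\<^sup>+\<omega>. ennreal (area_kernel \<omega> c) \<partial>M)
      \<le> (\<integral>\<^sup>+\<omega>. ennreal (c * discounted_area c (c / 2) \<omega>) + ennreal (c * discounted_area c (- c / 2) \<omega>) \<partial>M)"
  proof (intro nn_integral_mono)
    fix \<omega> assume \<omega>: "\<omega> \<in> space M"
    have "area_kernel \<omega> c \<le> c * (discounted_area c (c / 2) \<omega> + discounted_area c (- c / 2) \<omega>)"
      unfolding area_kernel_def distrib_left
      using c exp_area_le_discounted_area[OF \<omega>, of c "c / 2"] exp_area_le_discounted_area[OF \<omega>, of c "- c / 2"]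
      by (intro add_mono mult_left_mono) auto
    then have "ennreal (area_kernel \<omega> c) \<le> ennreal (c * discounted_area c (c / 2) \<omega> + c * discounted_area c (- c / 2) \<omega>)"
      by (intro ennreal_leI) (simp add: distrib_left)
    also have "\<dots> = ennreal (c * discounted_area c (c / 2) \<omega>) + ennreal (c * discounted_area c (- c / 2) \<omega>)"
      using c nonneg[OF \<omega>] by (intro ennreal_plus) auto
    finally show "ennreal (area_kernel \<omega> c) \<le> \<dots>" .
  qed
  also have "\<dots> = (\<integral>\<^sup>+\<omega>. ennreal (c * discounted_area c (c / 2) \<omega>) \<partial>M) + (\<integral>\<^sup>+\<omega>. ennreal (c * discounted_area c (- c / 2) \<omega>) \<partial>M)"
    by (rule nn_integral_add) measurable
  also have "\<dots> \<le> ennreal (4 / 3 * exp (- c / 2)) + ennreal (4 / 3 * exp (- c / 2))"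
    by (intro add_mono le) auto
  also have "\<dots> = ennreal (8 / 3 * exp (- c / 2))"
    by (subst ennreal_plus[symmetric]) auto
  finally show ?thesis .
qed

text \<open>
  The range \<open>1 / s \<le> c \<le> 2 / s\<close> with \<open>s = sqrt (T \<omega>)\<close>, that is \<open>1 \<le> v \<le> 2\<close> for \<open>v = c * s\<close>,
  contributes at least this much.
\<close>

lemma area_kernel_lower_bound:
  assumes \<omega>: "\<omega> \<in> space M" and T: "0 < T \<omega>"
  shows "ennreal (exp (- 2) * exp (\<bar>normalized_area W \<omega>\<bar> / 2))
    \<le> (\<integral>\<^sup>+c. ennreal (area_kernel \<omega> c) * indicator {0..} c \<partial>lborel)"
proof -
  define s where "s = sqrt (T \<omega>)"
  have s: "0 < s" "s\<^sup>2 = T \<omega>" using T by (simp_all add: s_def)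
  have sT: "T \<omega> powr (3 / 2) = s * T \<omega>"
  proof -
    have "T \<omega> powr (3 / 2) = T \<omega> powr (1 / 2 + 1)" by simp
    also have "\<dots> = T \<omega> powr (1 / 2) * T \<omega> powr 1" by (rule powr_add)
    finally show ?thesis using T by (simp add: s_def powr_half_sqrt)
  qed
  define b where "b = \<bar>normalized_area W \<omega>\<bar>"
  have b: "\<bar>area \<omega>\<bar> / T \<omega> = s * b"
    using s T by (simp add: b_def normalized_area_eq[OF \<omega>] sT abs_mult)
  have le: "s * (exp (- 2) * exp (b / 2)) \<le> area_kernel \<omega> c" if c: "1 / s \<le> c" "c \<le> 2 / s" for c
  proof -
    have c0: "0 \<le> c" using c s(1) by (meson divide_nonneg_pos order_trans zero_le_one)
    have cs: "1 \<le> c * s" "c * s \<le> 2" using c s(1) by (simp_all add: field_simps)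
    have "c\<^sup>2 / 2 * T \<omega> \<le> 2"
      using power_mono[OF cs(2), of 2] c0 s(1) by (simp add: power_mult_distrib s(2))
    then have 1: "exp (- 2) \<le> exp (- (c\<^sup>2 / 2 * T \<omega>))" by simp
    have "b / 2 \<le> c * s * b / 2"
      using mult_right_mono[OF cs(1), of b] by (simp add: b_def)
    also have "\<dots> = c / 2 * (\<bar>area \<omega>\<bar> / T \<omega>)" by (simp add: b)
    finally have "exp (b / 2) \<le> exp (c / 2 * (\<bar>area \<omega>\<bar> / T \<omega>))" by simp
    also have "\<dots> \<le> exp (c / 2 * area \<omega> / T \<omega>) + exp (- c / 2 * area \<omega> / T \<omega>)"
      by (cases "0 \<le> area \<omega>") auto
    finally have 2: "exp (b / 2) \<le> exp (c / 2 * area \<omega> / T \<omega>) + exp (- c / 2 * area \<omega> / T \<omega>)" .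
    have 3: "s \<le> c * T \<omega>"
    proof -
      have "1 * s \<le> (c * s) * s" using s(1) by (intro mult_right_mono cs) simp
      also have "\<dots> = c * T \<omega>" unfolding s(2)[symmetric] by (simp add: power2_eq_square)
      finally show ?thesis by simp
    qed
    have "s * (exp (- 2) * exp (b / 2)) \<le> (c * T \<omega>) * (exp (- (c\<^sup>2 / 2 * T \<omega>))
        * (exp (c / 2 * area \<omega> / T \<omega>) + exp (- c / 2 * area \<omega> / T \<omega>)))"
      using s c0 T by (intro mult_mono 1 2 3) auto
    also have "\<dots> = area_kernel \<omega> c" by (simp add: area_kernel_def mult_ac)
    finally show ?thesis .
  qed
  have "ennreal (exp (- 2) * exp (b / 2)) = ennreal (s * (exp (- 2) * exp (b / 2)) * (2 / s - 1 / s))"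
    using s by (simp add: field_simps)
  also have "\<dots> = (\<integral>\<^sup>+c. ennreal (s * (exp (- 2) * exp (b / 2))) * indicator {1 / s..2 / s} c \<partial>lborel)"
    using s by (subst nn_integral_cmult_indicator) (auto simp: divide_right_mono ennreal_mult'[symmetric] intro!: ennreal_cong)
  also have "\<dots> \<le> (\<integral>\<^sup>+c. ennreal (area_kernel \<omega> c) * indicator {0..} c \<partial>lborel)"
    using s le by (intro nn_integral_mono) (auto simp: indicator_def intro!: ennreal_leI order_trans[of 0 "1 / s"])
  finally show ?thesis by (simp add: b_def)
qed

text \<open>
  Tonelli's theorem for \<open>area_kernel\<close>: the integral over the paths and then over \<open>c\<close> is finite, and the
  integral over \<open>c\<close> alone dominates \<open>exp (\<bar>A\<bar> / 2)\<close> up to a factor. Paths with \<open>T = 0\<close> have \<open>A = 0\<close> and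
  account for the summand \<open>1\<close>.
\<close>

lemma exponential_moment_normalized_area:
  "(\<integral>\<^sup>+\<omega>. ennreal (exp (\<bar>normalized_area W \<omega>\<bar> / 2)) \<partial>M) < \<infinity>"
proof -
  let ?F = "\<lambda>\<omega>. \<integral>\<^sup>+c. ennreal (area_kernel \<omega> c) * indicator {0..} c \<partial>lborel"
  interpret pair: pair_sigma_finite M lborel ..
  have meas: "(\<lambda>(\<omega>, c). ennreal (area_kernel \<omega> c) * indicator {0..} c) \<in> borel_measurable (M \<Otimes>\<^sub>M lborel)"
    unfolding area_kernel_def by measurable
  have "(\<integral>\<^sup>+\<omega>. ?F \<omega> \<partial>M) = (\<integral>\<^sup>+c. (\<integral>\<^sup>+\<omega>. ennreal (area_kernel \<omega> c) * indicator {0..} c \<partial>M) \<partial>lborel)"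
    by (rule pair.Fubini'[OF meas, symmetric])
  also have "\<dots> \<le> (\<integral>\<^sup>+c. ennreal (8 / 3 * exp (- c / 2)) * indicator {0..} c \<partial>lborel)"
    using area_kernel_mean_le by (intro nn_integral_mono) (auto simp: indicator_def)
  also have "\<dots> = ennreal (0 - (- (16 / 3) * exp (- 0 / 2)))"
  proof (rule nn_integral_FTC_atLeast)
    show "((\<lambda>c. - (16 / 3) * exp (- c / 2) :: real) \<longlongrightarrow> 0) at_top" by real_asymp
  qed (auto intro!: derivative_eq_intros)
  also have "\<dots> = ennreal (16 / 3)" by simp
  finally have fin: "(\<integral>\<^sup>+\<omega>. ?F \<omega> \<partial>M) \<le> ennreal (16 / 3)" .
  have [measurable]: "?F \<in> borel_measurable M"
    using lborel.borel_measurable_nn_integral[OF meas] by simp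
  have "(\<integral>\<^sup>+\<omega>. ennreal (exp (\<bar>normalized_area W \<omega>\<bar> / 2)) \<partial>M) \<le> (\<integral>\<^sup>+\<omega>. 1 + ennreal (exp 2) * ?F \<omega> \<partial>M)"
  proof (rule nn_integral_mono)
    fix \<omega> assume \<omega>: "\<omega> \<in> space M"
    show "ennreal (exp (\<bar>normalized_area W \<omega>\<bar> / 2)) \<le> 1 + ennreal (exp 2) * ?F \<omega>"
    proof (cases "T \<omega> = 0")
      case True
      then show ?thesis by (simp add: normalized_area_eq[OF \<omega>])
    next
      case False
      then have "0 < T \<omega>" using T_nonneg[of \<omega>] by simp
      have "ennreal (exp (\<bar>normalized_area W \<omega>\<bar> / 2)) = ennreal (exp 2) * ennreal (exp (- 2) * exp (\<bar>normalized_area W \<omega>\<bar> / 2))"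
        by (simp flip: exp_add ennreal_mult')
      also have "\<dots> \<le> ennreal (exp 2) * ?F \<omega>"
        by (intro mult_left_mono area_kernel_lower_bound \<omega> \<open>0 < T \<omega>\<close>) auto
      also have "\<dots> \<le> 1 + ennreal (exp 2) * ?F \<omega>" by simp
      finally show ?thesis .
    qed
  qed
  also have "\<dots> = 1 + ennreal (exp 2) * (\<integral>\<^sup>+\<omega>. ?F \<omega> \<partial>M)"
    by (subst nn_integral_add) (auto simp: nn_integral_cmult emeasure_space_1)
  also have "\<dots> \<le> 1 + ennreal (exp 2) * ennreal (16 / 3)"
    by (intro add_left_mono mult_left_mono fin) simp
  also have "\<dots> < \<infinity>"
    by (simp add: ennreal_mult_less_top)
  finally show ?thesis .
qed

lemma admits_moments_normalized_area: "admits_moments_of_all_orders (normalized_area W)"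
  unfolding admits_moments_of_all_orders_def
proof (intro conjI allI impI)
  show "normalized_area W \<in> borel_measurable M" by (rule measurable_normalized_area)
  note [measurable] = this
  fix r :: real assume r: "0 < r"
  have "(\<integral>\<^sup>+\<omega>. ennreal (\<bar>normalized_area W \<omega>\<bar> powr r) \<partial>M)
      \<le> (\<integral>\<^sup>+\<omega>. ennreal ((2 * r) powr r) * ennreal (exp (\<bar>normalized_area W \<omega>\<bar> / 2)) \<partial>M)"
    using powr_le_exp_half[OF r] by (intro nn_integral_mono) (simp add: ennreal_leI flip: ennreal_mult')
  also have "\<dots> = ennreal ((2 * r) powr r) * (\<integral>\<^sup>+\<omega>. ennreal (exp (\<bar>normalized_area W \<omega>\<bar> / 2)) \<partial>M)"
    by (rule nn_integral_cmult) measurable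
  also have "\<dots> < \<infinity>"
    using exponential_moment_normalized_area by (simp add: ennreal_mult_less_top)
  finally show "(\<integral>\<^sup>+\<omega>. ennreal (\<bar>normalized_area W \<omega>\<bar> powr r) \<partial>M) < \<infinity>" .
qed

lemma integrable_normalized_area: "integrable M (normalized_area W)"
proof (rule integrableI_bounded)
  have "(\<integral>\<^sup>+\<omega>. ennreal (norm (normalized_area W \<omega>)) \<partial>M) = (\<integral>\<^sup>+\<omega>. ennreal (\<bar>normalized_area W \<omega>\<bar> powr 1) \<partial>M)"
    by (intro nn_integral_cong) simp
  also have "\<dots> < \<infinity>"
    by (rule admits_moments_normalized_area[unfolded admits_moments_of_all_orders_def, THEN conjunct2, rule_format]) simp
  finally show "(\<integral>\<^sup>+\<omega>. ennreal (norm (normalized_area W \<omega>)) \<partial>M) < \<infinity>" .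
qed (rule measurable_normalized_area)

end

section \<open>The mean\<close>

lemma exp_taylor2_bounds:
  fixes z :: real
  shows "0 \<le> exp z - 1 - z" "exp z - 1 - z \<le> z\<^sup>2 * exp \<bar>z\<bar>"
proof -
  show "0 \<le> exp z - 1 - z" using exp_ge_add_one_self[of z] by linarith
  have le: "exp x - 1 \<le> x * exp x" for x :: real
  proof -
    have "exp x * (1 - x) \<le> exp x * exp (- x)"
      using exp_ge_add_one_self[of "- x"] by (intro mult_left_mono) auto
    then show ?thesis by (simp flip: exp_add add: algebra_simps)
  qed
  show "exp z - 1 - z \<le> z\<^sup>2 * exp \<bar>z\<bar>"
  proof -
    have "exp z - 1 - z \<le> z * (exp z - 1)" using le[of z] by (simp add: algebra_simps)
    also have "\<dots> \<le> z\<^sup>2 * exp \<bar>z\<bar>"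
    proof (cases "0 \<le> z")
      case True
      then have "z * (exp z - 1) \<le> z * (z * exp z)" using le by (intro mult_left_mono) auto
      then show ?thesis using True by (simp add: power2_eq_square)
    next
      case False
      have "z * (exp z - 1) = (- z) * (1 - exp z)" by (simp add: algebra_simps)
      also have "\<dots> \<le> (- z) * (- z)"
        using False exp_ge_add_one_self[of z] by (intro mult_left_mono) (auto simp: algebra_simps)
      also have "\<dots> = z\<^sup>2 * 1" by (simp add: power2_eq_square)
      also have "\<dots> \<le> z\<^sup>2 * exp \<bar>z\<bar>" by (intro mult_left_mono) auto
      finally show ?thesis .
    qed
    finally show ?thesis .
  qed
qed

text \<open>
  For small \<open>a\<close> the quotient approximates \<open>x\<close>, with an error of order \<open>a\<close> times functions whose
  discounted integrals are under control. Both exponents are positive multiples of \<open>a\<close>, since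
  the exact formula \<open>discounted_area_eq\<close> covers \<open>a > 0\<close>.
\<close>

lemma exp_difference_quotient_bound:
  fixes a c x :: real
  assumes a: "0 < a" "8 * a \<le> c"
  shows "\<bar>(exp (2 * a * x) - exp (a * x)) / a - x\<bar> \<le> a * (128 / c\<^sup>2 * (exp (c / 2 * x) + exp (- c / 2 * x)))"
proof -
  define y where "y = a * x"
  have c: "0 < c" using a by simp
  have eq: "(exp (2 * a * x) - exp (a * x)) / a - x = (exp (2 * y) - exp y - y) / a"
    using a by (simp add: y_def field_simps)
  have y_le: "exp \<bar>y\<bar> \<le> exp \<bar>2 * y\<bar>" "y\<^sup>2 \<le> (2 * y)\<^sup>2" by (simp_all add: power_mult_distrib)
  have "y\<^sup>2 * exp \<bar>y\<bar> \<le> (2 * y)\<^sup>2 * exp \<bar>2 * y\<bar>"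
    by (intro mult_mono y_le) auto
  then have "\<bar>exp (2 * y) - exp y - y\<bar> \<le> (2 * y)\<^sup>2 * exp \<bar>2 * y\<bar>"
    using exp_taylor2_bounds[of y] exp_taylor2_bounds[of "2 * y"] by linarith
  also have "\<dots> = 4 * a\<^sup>2 * x\<^sup>2 * exp (2 * a * \<bar>x\<bar>)"
    using a by (simp add: y_def abs_mult power_mult_distrib)
  also have "\<dots> \<le> 4 * a\<^sup>2 * (32 / c\<^sup>2 * exp (c * \<bar>x\<bar> / 4)) * exp (c * \<bar>x\<bar> / 4)"
  proof (intro mult_mono mult_nonneg_nonneg)
    \<comment> \<open>\<open>t\<^sup>2 \<le> 2 * exp t\<close> absorbs the square at the cost of an exponential\<close>
    define t where "t = c * \<bar>x\<bar> / 4"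
    have "1 + t + t\<^sup>2 / 2 \<le> exp t"
      using c by (intro exp_lower_Taylor_quadratic) (simp add: t_def)
    moreover have "0 \<le> t" using c by (simp add: t_def)
    ultimately have "t\<^sup>2 \<le> 2 * exp t" by (simp add: field_simps)
    moreover have "x\<^sup>2 = 16 / c\<^sup>2 * t\<^sup>2" using c by (simp add: t_def power_mult_distrib power_divide)
    ultimately show "x\<^sup>2 \<le> 32 / c\<^sup>2 * exp (c * \<bar>x\<bar> / 4)"
      using c by (simp add: t_def[symmetric] divide_simps)
    have "8 * a * \<bar>x\<bar> \<le> c * \<bar>x\<bar>" using a by (intro mult_right_mono) auto
    then show "exp (2 * a * \<bar>x\<bar>) \<le> exp (c * \<bar>x\<bar> / 4)" by simp
  qed auto
  also have "\<dots> = a\<^sup>2 * (128 / c\<^sup>2 * exp (c / 2 * \<bar>x\<bar>))"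
    by (simp flip: exp_add)
  also have "\<dots> \<le> a\<^sup>2 * (128 / c\<^sup>2 * (exp (c / 2 * x) + exp (- c / 2 * x)))"
    by (intro mult_left_mono) (auto simp: abs_if)
  finally have "\<bar>exp (2 * y) - exp y - y\<bar> / a \<le> a\<^sup>2 * (128 / c\<^sup>2 * (exp (c / 2 * x) + exp (- c / 2 * x))) / a"
    using a by (intro divide_right_mono) auto
  then show ?thesis
    unfolding eq using a by (simp add: power2_eq_square)
qed

text \<open>
  Substitution \<open>x = c * sqrt (t / 2)\<close> in the second moment of \<open>exp (- x\<^sup>2)\<close>. The value of the constant does
  not matter for a mean that turns out to be \<open>0\<close>.
\<close>

lemma gaussian_second_moment_scaled:
  obtains \<gamma> :: real where "0 < \<gamma>"
    "\<And>t. 0 < t \<Longrightarrow> has_bochner_integral lborel (\<lambda>c. indicator {0..} c * (c\<^sup>2 * exp (- (c\<^sup>2 / 2 * t)))) (\<gamma> / t powr (3 / 2))"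
proof -
  define k :: real where "k = (sqrt pi / 2) * (fact (2 * 1) / (2 ^ (2 * 1) * fact 1))"
  have k: "0 < k" by (simp add: k_def)
  have base: "has_bochner_integral lborel (\<lambda>x::real. indicator {0..} x *\<^sub>R (exp (- x\<^sup>2) * x ^ (2 * 1))) k"
    unfolding k_def by (rule gaussian_moment_even_pos)
  show ?thesis
  proof
    show "0 < k * 2 powr (3 / 2)" using k by simp
    fix t :: real assume t: "0 < t"
    define s where "s = sqrt (t / 2)"
    have s: "0 < s" "s\<^sup>2 = t / 2" using t by (simp_all add: s_def)
    have "has_bochner_integral lborel (\<lambda>x::real. indicator {0..} (0 + s * x) *\<^sub>R (exp (- (0 + s * x)\<^sup>2) * (0 + s * x) ^ (2 * 1))) (k /\<^sub>R \<bar>s\<bar>)"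
      using base s by (subst (asm) lborel_has_bochner_integral_real_affine_iff[of s _ _ 0]) auto
    then have "has_bochner_integral lborel (\<lambda>x::real. (1 / s\<^sup>2) * (indicator {0..} (0 + s * x) *\<^sub>R (exp (- (0 + s * x)\<^sup>2) * (0 + s * x) ^ (2 * 1)))) ((1 / s\<^sup>2) * (k /\<^sub>R \<bar>s\<bar>))"
      by (rule has_bochner_integral_mult_right)
    moreover have "(1 / s\<^sup>2) * (indicator {0..} (0 + s * x) *\<^sub>R (exp (- (0 + s * x)\<^sup>2) * (0 + s * x) ^ (2 * 1)))
        = indicator {0..} x * (x\<^sup>2 * exp (- (x\<^sup>2 / 2 * t)))" for x
    proof -
      have "indicator {0..} (s * x) = (indicator {0..} x :: real)"
        using s by (auto simp: indicator_def zero_le_mult_iff)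
      moreover have "exp (- (0 + s * x)\<^sup>2) = exp (- (x\<^sup>2 / 2 * t))"
        by (simp add: power_mult_distrib s(2))
      moreover have "(0 + s * x) ^ (2 * 1) = s\<^sup>2 * x\<^sup>2" by (simp add: power_mult_distrib)
      ultimately show ?thesis using s(1) by (simp only:) simp
    qed
    moreover have "(1 / s\<^sup>2) * (k /\<^sub>R \<bar>s\<bar>) = k * 2 powr (3 / 2) / t powr (3 / 2)"
    proof -
      have "s\<^sup>2 * s = s powr 2 * s powr 1" using s by (simp add: powr_numeral)
      also have "\<dots> = s powr 3" by (subst powr_add[symmetric]) simp
      also have "\<dots> = (t / 2) powr (3 / 2)" using t by (simp add: s_def powr_half_sqrt[symmetric] powr_powr)
      also have "\<dots> = t powr (3 / 2) / 2 powr (3 / 2)" using t by (simp add: powr_divide)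
      finally have eq: "s\<^sup>2 * s = t powr (3 / 2) / 2 powr (3 / 2)" .
      have "(1 / s\<^sup>2) * (k /\<^sub>R \<bar>s\<bar>) = k / (s\<^sup>2 * s)"
        using s(1) by (simp add: divide_inverse)
      then show ?thesis unfolding eq by simp
    qed
    ultimately show "has_bochner_integral lborel (\<lambda>c. indicator {0..} c * (c\<^sup>2 * exp (- (c\<^sup>2 / 2 * t)))) (k * 2 powr (3 / 2) / t powr (3 / 2))"
      by simp
  qed
qed

text \<open>
  Both \<open>c * exp (- c)\<close> and \<open>exp (- c)\<close> have integral \<open>1\<close> over the half-line.
\<close>

lemma exp_moment_difference:
  "(LBINT c. indicator {0..} c * ((c - 1) / 2 * exp (- c))) = (0 :: real)"
proof -
  have int: "has_bochner_integral lborel (\<lambda>c::real. indicator {0..} c * (c ^ k * exp (- c))) (fact k)" for k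
  proof (rule has_bochner_integral_nn_integral)
    show "(\<integral>\<^sup>+c. ennreal (indicator {0..} c * (c ^ k * exp (- c))) \<partial>lborel) = ennreal (fact k)"
      by (rule trans[OF nn_integral_cong nn_intergal_power_times_exp_Ici[of k, simplified]])
         (simp add: indicator_def)
  qed (auto simp: indicator_def)
  have "has_bochner_integral lborel (\<lambda>c::real. (indicator {0..} c * (c ^ 1 * exp (- c)) - indicator {0..} c * (c ^ 0 * exp (- c))) / 2)
     ((fact 1 - fact 0) / 2)"
    by (intro has_bochner_integral_divide has_bochner_integral_diff int)
  moreover have "(indicator {0..} c * (c ^ 1 * exp (- c)) - indicator {0..} c * (c ^ 0 * exp (- c))) / 2
    = indicator {0..} c * ((c - 1) / 2 * exp (- c))" for c :: real
    by (simp add: algebra_simps diff_divide_distrib)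
  ultimately have "has_bochner_integral lborel (\<lambda>c::real. indicator {0..} c * ((c - 1) / 2 * exp (- c))) ((fact 1 - fact 0) / 2)"
    by (simp only:)
  then show ?thesis by (subst has_bochner_integral_integral_eq) auto
qed

context brownian_motion_from_0

begin

lemma discounted_area_integrable:
  assumes "0 < c" "0 \<le> c + a" "a \<noteq> 0"
  shows "integrable M (discounted_area c a)"
proof (rule integrableI_nonneg)
  show "AE \<omega> in M. 0 \<le> discounted_area c a \<omega>"
    using T_nonneg by (intro AE_I2 order_trans[OF _ exp_area_le_discounted_area]) auto
  show "(\<integral>\<^sup>+\<omega>. ennreal (discounted_area c a \<omega>) \<partial>M) < \<infinity>"
    using discounted_area_le[OF assms] by (rule le_less_trans) simp
qed measurable

lemma discounted_area_difference_quotient: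
  assumes \<omega>: "\<omega> \<in> space M" and a: "0 < a" "8 * a \<le> c"
  shows "\<bar>(discounted_area c (2 * a) \<omega> - discounted_area c a \<omega>) / a - exp (- (c\<^sup>2 / 2 * T \<omega>)) * area \<omega>\<bar>
    \<le> a * (128 / c\<^sup>2 * (discounted_area c (c / 2) \<omega> + discounted_area c (- c / 2) \<omega>))"
proof -
  let ?e = "exp (- (c\<^sup>2 / 2 * T \<omega>))" and ?I = "\<lambda>f. integral {0..T \<omega>} (\<lambda>s. f (W s \<omega>))"
  have int: "(\<lambda>s. f (W s \<omega>)) integrable_on {0..T \<omega>}" if "continuous_on UNIV f" for f :: "real \<Rightarrow> real"
    by (intro integrable_continuous_real continuous_on_compose2[OF that]
        continuous_on_subset[OF continuous_paths[OF \<omega>]]) auto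
  define u where "u x = (exp (2 * a * x) - exp (a * x)) / a - x" for x
  define v where "v x = a * (128 / c\<^sup>2 * (exp (c / 2 * x) + exp (- c / 2 * x)))" for x
  have cont: "continuous_on UNIV u" "continuous_on UNIV v"
    unfolding u_def v_def by (intro continuous_intros; use a in simp)+
  have cexp: "continuous_on UNIV (\<lambda>x::real. exp (b * x))" for b by (intro continuous_intros)
  have "(discounted_area c (2 * a) \<omega> - discounted_area c a \<omega>) / a - ?e * area \<omega> = ?e * ?I u"
  proof -
    have "?I u = (?I (\<lambda>x. exp (2 * a * x)) - ?I (\<lambda>x. exp (a * x))) / a - ?I (\<lambda>x. x)"
      unfolding u_def
      by (simp add: Henstock_Kurzweil_Integration.integral_diff int[OF cexp] int[of "\<lambda>x. x"]
          integrable_diff integrable_on_divide)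
    then show ?thesis
      by (simp add: discounted_area_def area_def right_diff_distrib diff_divide_distrib)
  qed
  moreover have "?e * ?I v = a * (128 / c\<^sup>2 * (discounted_area c (c / 2) \<omega> + discounted_area c (- c / 2) \<omega>))"
  proof -
    have "?I v = a * (128 / c\<^sup>2 * (?I (\<lambda>x. exp (c / 2 * x)) + ?I (\<lambda>x. exp (- c / 2 * x))))"
      unfolding v_def
      by (simp only: Henstock_Kurzweil_Integration.integral_mult_right
          Henstock_Kurzweil_Integration.integral_add[OF int[OF cexp] int[OF cexp]])
    then show ?thesis
      by (simp add: discounted_area_def algebra_simps)
  qed
  moreover have "\<bar>?I u\<bar> \<le> ?I v"
    unfolding real_norm_def[symmetric]
    using exp_difference_quotient_bound[OF a]
    by (intro integral_norm_bound_integral int cont) (simp add: u_def v_def)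
  then have "\<bar>?e * ?I u\<bar> \<le> ?e * ?I v"
    by (simp add: abs_mult mult_left_mono)
  ultimately show ?thesis by simp
qed

text \<open>
  The derivative at \<open>a = 0\<close> of \<open>discounted_area_eq\<close>, taken as a limit of the difference quotients with
  the points \<open>2 * a\<close> and \<open>a\<close>.
\<close>

lemma discounted_first_moment:
  assumes c: "0 < c"
  shows "integrable M (\<lambda>\<omega>. exp (- (c\<^sup>2 / 2 * T \<omega>)) * area \<omega>)"
    "expectation (\<lambda>\<omega>. exp (- (c\<^sup>2 / 2 * T \<omega>)) * area \<omega>) = exp (- c) * (1 / (2 * c) - 1 / (2 * c\<^sup>2))"
proof -
  define H where "H \<omega> = exp (- (c\<^sup>2 / 2 * T \<omega>)) * area \<omega>" for \<omega>
  define Q where "Q a \<omega> = (discounted_area c (2 * a) \<omega> - discounted_area c a \<omega>) / a" for a \<omega>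
  define V where "V \<omega> = 128 / c\<^sup>2 * (discounted_area c (c / 2) \<omega> + discounted_area c (- c / 2) \<omega>)" for \<omega>
  define v where "v a = exp (- c) * (exp a - 1) / (a\<^sup>2 / 2 + c * a)" for a
  have [measurable]: "H \<in> borel_measurable M" unfolding H_def by measurable
  have V: "integrable M V"
    unfolding V_def using c
    by (intro integrable_mult_right Bochner_Integration.integrable_add discounted_area_integrable) auto
  have Q: "integrable M (Q a)" "expectation (Q a) = (v (2 * a) - v a) / a" if "0 < a" for a
    unfolding Q_def v_def using discounted_area_eq[OF c that] discounted_area_eq[OF c, of "2 * a"] that
    by simp_all
  have diff: "\<bar>Q a \<omega> - H \<omega>\<bar> \<le> a * V \<omega>" if "\<omega> \<in> space M" "0 < a" "8 * a \<le> c" for a \<omega>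
    unfolding Q_def H_def V_def by (rule discounted_area_difference_quotient[OF that])
  have diff_int: "integrable M (\<lambda>\<omega>. Q a \<omega> - H \<omega>)" if a: "0 < a" "8 * a \<le> c" for a
  proof (rule Bochner_Integration.integrable_bound)
    show "integrable M (\<lambda>\<omega>. a * V \<omega>)" using V by simp
    show "(\<lambda>\<omega>. Q a \<omega> - H \<omega>) \<in> borel_measurable M"
      using Q(1)[OF a(1)] by measurable
    show "AE \<omega> in M. norm (Q a \<omega> - H \<omega>) \<le> norm (a * V \<omega>)"
      using diff[OF _ a] by (intro AE_I2) force
  qed
  \<comment> \<open>any \<open>a\<close> with \<open>8 * a \<le> c\<close> shows integrability\<close>
  have "integrable M (\<lambda>\<omega>. Q (c / 8) \<omega> - (Q (c / 8) \<omega> - H \<omega>))"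
    using c by (intro Bochner_Integration.integrable_diff diff_int Q(1)) auto
  then have H: "integrable M H" by simp
  then show "integrable M (\<lambda>\<omega>. exp (- (c\<^sup>2 / 2 * T \<omega>)) * area \<omega>)" by (simp add: H_def[abs_def])
  have bound: "\<bar>(v (2 * a) - v a) / a - expectation H\<bar> \<le> a * expectation V" if a: "0 < a" "8 * a \<le> c" for a
  proof -
    have "(v (2 * a) - v a) / a - expectation H = expectation (\<lambda>\<omega>. Q a \<omega> - H \<omega>)"
      using Q[OF a(1)] H by simp
    also have "\<bar>\<dots>\<bar> \<le> expectation (\<lambda>\<omega>. \<bar>Q a \<omega> - H \<omega>\<bar>)"
      by (rule integral_abs_bound)
    also have "\<dots> \<le> expectation (\<lambda>\<omega>. a * V \<omega>)"
      using diff_int[OF a] V diff[OF _ a] by (intro integral_mono) auto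
    finally show ?thesis by simp
  qed
  have ev: "eventually (\<lambda>a. 0 < a \<and> 8 * a \<le> c) (at_right 0)"
    using eventually_at_right_real[of 0 "c / 8"] c by (auto elim: eventually_mono)
  have "((\<lambda>a. (v (2 * a) - v a) / a - expectation H) \<longlongrightarrow> 0) (at_right 0)"
  proof (rule Lim_null_comparison)
    show "eventually (\<lambda>a. norm ((v (2 * a) - v a) / a - expectation H) \<le> a * expectation V) (at_right 0)"
      using ev by eventually_elim (use bound in auto)
    show "((\<lambda>a. a * expectation V) \<longlongrightarrow> 0) (at_right 0)"
      by (auto intro!: tendsto_eq_intros)
  qed
  then have "((\<lambda>a. (v (2 * a) - v a) / a) \<longlongrightarrow> expectation H) (at_right 0)"
    by (rule LIM_zero_cancel)
  moreover have "((\<lambda>a. (v (2 * a) - v a) / a) \<longlongrightarrow> exp (- c) * (1 / (2 * c) - 1 / (2 * c\<^sup>2))) (at_right 0)"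
    unfolding v_def using c by real_asymp (simp add: field_simps power2_eq_square)
  ultimately have "expectation H = exp (- c) * (1 / (2 * c) - 1 / (2 * c\<^sup>2))"
    by (rule tendsto_unique[rotated]) simp
  then show "expectation (\<lambda>\<omega>. exp (- (c\<^sup>2 / 2 * T \<omega>)) * area \<omega>) = exp (- c) * (1 / (2 * c) - 1 / (2 * c\<^sup>2))"
    by (simp add: H_def[abs_def])
qed

text \<open>
  Fubini's theorem for the representation of \<open>T\<^bsup>-3/2\<^esup>\<close> as a Gaussian integral over \<open>c\<close>. It applies
  because the normalized area is already known to be integrable.
\<close>

lemma expectation_normalized_area: "expectation (normalized_area W) = 0"
proof -
  obtain \<gamma> :: real where \<gamma>: "0 < \<gamma>"
    "\<And>t. 0 < t \<Longrightarrow> has_bochner_integral lborel (\<lambda>c. indicator {0..} c * (c\<^sup>2 * exp (- (c\<^sup>2 / 2 * t)))) (\<gamma> / t powr (3 / 2))"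
    by (rule gaussian_second_moment_scaled) blast
  define F where "F \<omega> c = indicator {0..} c * (c\<^sup>2 * exp (- (c\<^sup>2 / 2 * T \<omega>))) * area \<omega>" for \<omega> and c :: real
  have F: "has_bochner_integral lborel (F \<omega>) (\<gamma> * normalized_area W \<omega>)"
    "has_bochner_integral lborel (\<lambda>c. norm (F \<omega> c)) (\<gamma> * \<bar>normalized_area W \<omega>\<bar>)" if \<omega>: "\<omega> \<in> space M" for \<omega>
  proof -
    have "has_bochner_integral lborel (\<lambda>c. indicator {0..} c * (c\<^sup>2 * exp (- (c\<^sup>2 / 2 * T \<omega>))) * x)
      (\<gamma> / T \<omega> powr (3 / 2) * x)" if "x = 0 \<or> 0 < T \<omega>" for x
      using that
    proof
      assume "0 < T \<omega>"
      from has_bochner_integral_mult_left[OF \<gamma>(2)[OF this], of x] show ?thesis by simp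
    qed (simp add: has_bochner_integral_zero)
    note this[of "area \<omega>"] this[of "\<bar>area \<omega>\<bar>"]
    moreover have "area \<omega> = 0 \<or> 0 < T \<omega>"
      using area_T_0[of \<omega>] T_nonneg[of \<omega>] by linarith
    ultimately show "has_bochner_integral lborel (F \<omega>) (\<gamma> * normalized_area W \<omega>)"
      "has_bochner_integral lborel (\<lambda>c. norm (F \<omega> c)) (\<gamma> * \<bar>normalized_area W \<omega>\<bar>)"
      by (auto simp: F_def[abs_def] normalized_area_eq[OF \<omega>] abs_mult)
  qed
  interpret pair: pair_sigma_finite M lborel ..
  have meas: "(\<lambda>(\<omega>, c). F \<omega> c) \<in> borel_measurable (M \<Otimes>\<^sub>M lborel)"
    unfolding F_def by measurable
  have "integrable (M \<Otimes>\<^sub>M lborel) (\<lambda>(\<omega>, c). F \<omega> c)"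
  proof (rule pair.Fubini_integrable[OF meas])
    have eq: "(LBINT c. norm (case (\<omega>, c) of (\<omega>, c) \<Rightarrow> F \<omega> c)) = \<gamma> * \<bar>normalized_area W \<omega>\<bar>"
      if "\<omega> \<in> space M" for \<omega>
      using has_bochner_integral_integral_eq[OF F(2)[OF that]] by simp
    show "integrable M (\<lambda>\<omega>. LBINT c. norm (case (\<omega>, c) of (\<omega>, c) \<Rightarrow> F \<omega> c))"
      by (rule Bochner_Integration.integrable_cong[OF refl eq, THEN iffD2])
         (use integrable_normalized_area in simp_all)
    show "AE \<omega> in M. integrable lborel (\<lambda>c. case (\<omega>, c) of (\<omega>, c) \<Rightarrow> F \<omega> c)"
      using F(1) by (auto intro!: AE_I2 simp: has_bochner_integral_iff)
  qed
  then have "(LBINT c. expectation (\<lambda>\<omega>. F \<omega> c)) = expectation (\<lambda>\<omega>. LBINT c. F \<omega> c)"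
    by (rule pair.Fubini_integral)
  also have "\<dots> = expectation (\<lambda>\<omega>. \<gamma> * normalized_area W \<omega>)"
    using F(1) by (intro Bochner_Integration.integral_cong) (auto simp: has_bochner_integral_iff)
  also have "\<dots> = \<gamma> * expectation (normalized_area W)" by simp
  finally have "\<gamma> * expectation (normalized_area W) = (LBINT c. expectation (\<lambda>\<omega>. F \<omega> c))" ..
  also have "\<dots> = (LBINT c. indicator {0..} c * ((c - 1) / 2 * exp (- c)))"
  proof (rule integral_cong_AE)
    \<comment> \<open>at \<open>c = 0\<close> the two integrands differ\<close>
    have "AE c in lborel. c \<noteq> (0::real)" by (rule AE_lborel_singleton)
    then show "AE c in lborel. expectation (\<lambda>\<omega>. F \<omega> c) = indicator {0..} c * ((c - 1) / 2 * exp (- c))"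
    proof eventually_elim
      case (elim c)
      show ?case
      proof (cases "0 < c")
        case True
        have "expectation (\<lambda>\<omega>. F \<omega> c) = expectation (\<lambda>\<omega>. c\<^sup>2 * (exp (- (c\<^sup>2 / 2 * T \<omega>)) * area \<omega>))"
          using True by (intro Bochner_Integration.integral_cong) (auto simp: F_def)
        also have "\<dots> = c\<^sup>2 * (exp (- c) * (1 / (2 * c) - 1 / (2 * c\<^sup>2)))"
          using discounted_first_moment[OF True] by simp
        also have "\<dots> = (c - 1) / 2 * exp (- c)"
          using True by (simp add: power2_eq_square field_simps)
        finally show ?thesis using True by simp
      qed (use elim in \<open>simp add: F_def\<close>)
    qed
    show "(\<lambda>c. expectation (\<lambda>\<omega>. F \<omega> c)) \<in> borel_measurable lborel"
      unfolding F_def by measurable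
  qed measurable
  also have "\<dots> = 0" by (rule exp_moment_difference)
  finally show ?thesis using \<gamma>(1) by simp
qed

end

section \<open>Brownian motion that starts at 0 almost surely\<close>

lemma brownian_motion_from_0_shift:
  assumes "standard_brownian_motion M B"
  shows "brownian_motion_from_0 M (\<lambda>t \<omega>. B t \<omega> - B 0 \<omega>)"
proof -
  interpret standard_brownian_motion M B by fact
  have incr: "(B t \<omega> - B 0 \<omega>) - (B s \<omega> - B 0 \<omega>) = B t \<omega> - B s \<omega>" for s t \<omega> by simp
  show ?thesis
  proof unfold_locales
    show "(\<lambda>\<omega>. B t \<omega> - B 0 \<omega>) \<in> borel_measurable M" if "0 \<le> t" for t
      using random_variable_at[of t] random_variable_at[of 0] that by simp
    show "continuous_on {0..} (\<lambda>t. B t \<omega> - B 0 \<omega>)" if "\<omega> \<in> space M" for \<omega>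
      by (intro continuous_intros continuous_paths that)
  qed (simp_all only: incr, auto intro: indep_increments normal_increments)
qed

theorem theorem2p1:
  fixes M :: "'a measure" and B :: "real \<Rightarrow> 'a \<Rightarrow> real"
  assumes "standard_brownian_motion M B"
  shows "prob_space.admits_moments_of_all_orders M (normalized_area B)
    \<and> prob_space.expectation M (normalized_area B) = 0"
proof -
  interpret B: standard_brownian_motion M B by fact
  define W where "W t \<omega> = B t \<omega> - B 0 \<omega>" for t \<omega>
  interpret W: brownian_motion_from_0 M W
    unfolding W_def by (rule brownian_motion_from_0_shift) fact
  have eq: "AE \<omega> in M. normalized_area B \<omega> = normalized_area W \<omega>"
    using B.starts_at_0
    by eventually_elim (simp add: normalized_area_def hitting_time_def W_def)
  have meas: "normalized_area B \<in> borel_measurable M"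
  proof -
    have [measurable]: "hitting_time B 1 \<in> borel_measurable M"
      by (rule measurable_hitting_time[OF B.random_variable_at B.continuous_paths])
    have [measurable]: "(\<lambda>\<omega>. LBINT s:{0..enn2real (hitting_time B 1 \<omega>)}. B s \<omega>) \<in> borel_measurable M"
      by (rule measurable_path_integral[OF B.random_variable_at B.continuous_paths]) measurable
    show ?thesis unfolding normalized_area_def Let_def by measurable
  qed
  have "(\<integral>\<^sup>+\<omega>. ennreal (\<bar>normalized_area B \<omega>\<bar> powr r) \<partial>M) = (\<integral>\<^sup>+\<omega>. ennreal (\<bar>normalized_area W \<omega>\<bar> powr r) \<partial>M)" for r
    using eq by (intro nn_integral_cong_AE) auto
  moreover have "B.expectation (normalized_area B) = B.expectation (normalized_area W)"
    using eq by (intro integral_cong_AE meas W.measurable_normalized_area)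
  ultimately show ?thesis
    using meas W.admits_moments_normalized_area W.expectation_normalized_area
    by (simp add: B.admits_moments_of_all_orders_def)
qed

end
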